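(* Let $R$ be a nonempty finite set, let $\nu_r>0$, $\mu_r>0$ and $\kappa_r=\nu_r/\mu_r$ for $r\in R$. Let $\boldsymbol{b}=(b_r(\boldsymbol{n}),\ r\in R,\ \boldsymbol{n}\in\mathbb{Z}_+^{|R|})$ be a monotonic control, and let $S\subseteq R$ (possibly empty) be such that $\boldsymbol{b}^S$ is stable, with $\pi^S$ the corresponding stationary distribution on $\mathbb{Z}_+^{|S|}$. (i) If $r\in R\setminus S$ is such that $$\mathbf{E}_{\pi^S} b^S_r>\kappa_r,$$ then $\boldsymbol{b}^{S\cup\{r\}}$ is stable. (ii) If $r\in R\setminus S$ is such that $$\mathbf{E}_{\pi^S} b^S_r<\kappa_r,$$ then $\boldsymbol{b}^{S\cup\{r\}}$ is unstable.
   Context: $\mathbb{Z}_+=\{0,1,2,\dots\}$ and $\mathbb{R}_+=[0,\infty)$. A control is a function $\boldsymbol{b}:\mathbb{Z}_+^{|R|}\to\mathbb{R}_+^{|R|}$, $\boldsymbol{n}\mapsto(b_r(\boldsymbol{n}),\,r\in R)$, where $\boldsymbol{n}=(n_r,\,r\in R)$, such that $b_r(\boldsymbol{n})=0$ whenever $n_r=0$. It defines the continuous-time Markov process $\boldsymbol{n}(\cdot)$ on $\mathbb{Z}_+^{|R|}$ with transition rates, for each $r\in R$: $\boldsymbol{n}\to\boldsymbol{n}+\boldsymbol{e}_r$ at rate $\nu_r$, and $\boldsymbol{n}\to\boldsymbol{n}-\boldsymbol{e}_r$ at rate $\mu_r b_r(\boldsymbol{n})$, where $\boldsymbol{e}_r$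 is the unit vector in coordinate $r$. Here $n_r$ is the number of calls of type $r$. The control is bounded if each $b_r(\boldsymbol{n})$ is bounded in $\boldsymbol{n}$. A bounded control is monotonic if, for all $r\in R$: $b_r(\boldsymbol{n})$ is increasing (not necessarily strictly) in $n_r$ with all other coordinates fixed; and, for all $s\ne r$, $b_r(\boldsymbol{n})$ is decreasing (not necessarily strictly) in $n_s$ with all other coordinates fixed. For a monotonic control $\boldsymbol{b}$ and $S\subseteq R$, write $\boldsymbol{n}_S=(n_s,\,s\in S)$ and define $\boldsymbol{b}^S:\mathbb{Z}_+^{|S|}\to\mathbb{R}_+^{|R|}$ by $$b^S_r(\boldsymbol{n}_S)=\lim_{n_s\to\infty\ \forall s\notin S} b_r(\boldsymbol{n}),\quad r\in S,$$ $$b^S_r(\boldsymbol{n}_S)=\lim_{n_r\to\infty}\ \lim_{n_s\to\infty\ \forall s\notin S\cup\{r\}} b_r(\boldsymbol{n}),\quad r\notin S,$$ where the coordinates of $\boldsymbol{n}$ in $S$ are held fixed at $\boldsymbol{n}_S$; in the second definition the limit $n_r\to\infty$ is taken last. These limits exist by monotonicity, and the order in which the other limits are taken is irrelevant. $\boldsymbol{b}^S$ is called stable if the Markov process $\boldsymbol{n}^S(\cdot)$ on $\mathbb{Z}_+^{|S|}$ with transition rates $\boldsymbol{n}_S\to\boldsymbol{n}_S+\boldsymbol{e}_s$ at rate $\nu_s$ and $\boldsymbol{n}_S\to\boldsymbol{n}_S-\boldsymbol{e}_s$ at rate $\mu_s b^S_s(\boldsymbol{n}_S)$, $s\in S$,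 is positive recurrent; otherwise it is unstable. Positive recurrence is understood as the existence of a stationary distribution (necessarily unique here, because upward transitions always have positive rate, so any two states have a common accessible state); for an irreducible process this is the usual notion. When $\boldsymbol{b}^S$ is stable, $\pi^S$ denotes the stationary distribution of $\boldsymbol{n}^S(\cdot)$ and, for every $r\in R$, $$\mathbf{E}_{\pi^S}b^S_r=\sum_{\boldsymbol{n}_S\in\mathbb{Z}_+^{|S|}}\pi^S(\boldsymbol{n}_S)\,b^S_r(\boldsymbol{n}_S).$$ By convention, for $S=\emptyset$, $\boldsymbol{b}^\emptyset$ is a vector of constants, is always stable, and $\mathbf{E}_{\pi^\emptyset}b^\emptyset_r=b^\emptyset_r$. Note $\boldsymbol{b}^R=\boldsymbol{b}$. *)

theory Defs
  imports "HOL-Probability.Probability"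
begin

subsection \<open>Continuous-time Markov processes given by their transition rates\<close>

text \<open>The generator of the transition rates \<open>q x y\<close>, \<open>x \<noteq> y\<close>, on the state space \<open>E\<close>;
  the values \<open>q x x\<close> are irrelevant.\<close>

definition generator :: "'a set \<Rightarrow> ('a \<Rightarrow> 'a \<Rightarrow> real) \<Rightarrow> 'a \<Rightarrow> 'a \<Rightarrow> real" where
  "generator E q x y = (if x = y then - (\<Sum>\<^sub>\<infinity>z\<in>E - {x}. q x z) else q x y)"

text \<open>\<open>P t x\<close> is the law at time \<open>t\<close> of the process started in \<open>x\<close>. If the total rates out of
  the states are bounded, as for all processes considered below, there is exactly one such \<open>P\<close>
  (up to its values outside \<open>E\<close> and at negative times).\<close>

definition markov_semigroup ::
    "'a set \<Rightarrow> ('a \<Rightarrow> 'a \<Rightarrow> real) \<Rightarrow> (real \<Rightarrow> 'a \<Rightarrow> 'a pmf) \<Rightarrow> bool" where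
  "markov_semigroup E q P \<longleftrightarrow>
    (\<forall>t\<ge>0. \<forall>x\<in>E. set_pmf (P t x) \<subseteq> E) \<and>
    (\<forall>x\<in>E. P 0 x = return_pmf x) \<and>
    (\<forall>s\<ge>0. \<forall>t\<ge>0. \<forall>x\<in>E. P (s + t) x = bind_pmf (P s x) (P t)) \<and>
    (\<forall>x\<in>E. \<forall>y\<in>E. ((\<lambda>t. pmf (P t x) y) has_real_derivative generator E q x y) (at 0 within {0..}))"

definition stationary_distribution ::
    "'a set \<Rightarrow> ('a \<Rightarrow> 'a \<Rightarrow> real) \<Rightarrow> 'a pmf \<Rightarrow> bool" where
  "stationary_distribution E q \<pi> \<longleftrightarrow> set_pmf \<pi> \<subseteq> E \<and>
    (\<exists>P. markov_semigroup E q P \<and> (\<forall>t\<ge>0. bind_pmf \<pi> (P t) = \<pi>))"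

definition positive_recurrent :: "'a set \<Rightarrow> ('a \<Rightarrow> 'a \<Rightarrow> real) \<Rightarrow> bool" where
  "positive_recurrent E q \<longleftrightarrow> (\<exists>\<pi>. stationary_distribution E q \<pi>)"

subsection \<open>Controls\<close>

text \<open>The index set \<open>R\<close> is the finite type \<open>'r\<close>.\<close>

definition control :: "(('r \<Rightarrow> nat) \<Rightarrow> 'r \<Rightarrow> real) \<Rightarrow> bool" where
  "control b \<longleftrightarrow> (\<forall>n r. 0 \<le> b n r) \<and> (\<forall>n r. n r = 0 \<longrightarrow> b n r = 0)"

definition bounded_control :: "(('r \<Rightarrow> nat) \<Rightarrow> 'r \<Rightarrow> real) \<Rightarrow> bool" where
  "bounded_control b \<longleftrightarrow> control b \<and> (\<forall>r. bounded (range (\<lambda>n. b n r)))"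

definition monotonic_control :: "(('r \<Rightarrow> nat) \<Rightarrow> 'r \<Rightarrow> real) \<Rightarrow> bool" where
  "monotonic_control b \<longleftrightarrow> bounded_control b \<and>
    (\<forall>r n. mono (\<lambda>k. b (n(r := k)) r)) \<and>
    (\<forall>r s n. s \<noteq> r \<longrightarrow> antimono (\<lambda>k. b (n(s := k)) r))"

subsection \<open>Limiting controls\<close>

text \<open>The coordinates in \<open>S\<close> are fixed at their values in \<open>n\<close>; all others tend to infinity,
  jointly and independently of each other.\<close>

definition to_infinity_outside :: "'r set \<Rightarrow> ('r \<Rightarrow> nat) \<Rightarrow> ('r \<Rightarrow> nat) filter" where
  "to_infinity_outside S n =
    (INF s. filtercomap (\<lambda>m. m s) (if s \<in> S then principal {n s} else at_top))"

text \<open>The value does not depend on the coordinates of \<open>n\<close> outside \<open>S\<close>.\<close>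

definition limit_control ::
    "(('r \<Rightarrow> nat) \<Rightarrow> 'r \<Rightarrow> real) \<Rightarrow> 'r set \<Rightarrow> ('r \<Rightarrow> nat) \<Rightarrow> 'r \<Rightarrow> real" where
  "limit_control b S n r =
    (if r \<in> S then Lim (to_infinity_outside S n) (\<lambda>m. b m r)
     else Lim at_top (\<lambda>k. Lim (to_infinity_outside (insert r S) (n(r := k))) (\<lambda>m. b m r)))"

subsection \<open>The process restricted to a set of call types\<close>

text \<open>An element of the state space indexed by \<open>S\<close> is an extensional function on \<open>S\<close>. In the
  departure term, \<open>n = n'(s := n' s + 1)\<close> says that \<open>n'\<close> is \<open>n\<close> minus the unit vector of \<open>s\<close>.\<close>

definition states :: "'r set \<Rightarrow> ('r \<Rightarrow> nat) set" where
  "states S = S \<rightarrow>\<^sub>E UNIV"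

definition rates ::
    "('r \<Rightarrow> real) \<Rightarrow> ('r \<Rightarrow> real) \<Rightarrow> (('r \<Rightarrow> nat) \<Rightarrow> 'r \<Rightarrow> real) \<Rightarrow> 'r set
      \<Rightarrow> ('r \<Rightarrow> nat) \<Rightarrow> ('r \<Rightarrow> nat) \<Rightarrow> real" where
  "rates \<nu> \<mu> b S n n' =
    (\<Sum>s\<in>S. (if n' = n(s := n s + 1) then \<nu> s else 0)
          + (if n = n'(s := n' s + 1) then \<mu> s * limit_control b S n s else 0))"

definition stable_control ::
    "('r \<Rightarrow> real) \<Rightarrow> ('r \<Rightarrow> real) \<Rightarrow> (('r \<Rightarrow> nat) \<Rightarrow> 'r \<Rightarrow> real) \<Rightarrow> 'r set \<Rightarrow> bool" where
  "stable_control \<nu> \<mu> b S \<longleftrightarrow> positive_recurrent (states S) (rates \<nu> \<mu> b S)"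

end

theory Submission
  imports Defs
begin

text \<open>All transition rates are bounded, so stationary distributions of the continuous-time processes
  are the invariant distributions of discrete-time chains, uniformized at a common rate. By
  monotonicity these chains preserve increasing functions, and the coordinates in \<open>S\<close> of the process
  on \<open>S \<union> {r}\<close> are stochastically dominated by the process on \<open>S\<close>.

  (i) The law of the process on \<open>S \<union> {r}\<close> started empty increases stochastically and converges
  pointwise; if there is no stationary distribution, it converges to 0. Since the coordinates in \<open>S\<close>
  are dominated by \<open>\<pi>\<close>, the coordinate \<open>r\<close> then tends to infinity in probability, so that its mean
  departure rate is eventually close to at least \<open>\<mu> r\<close> times the mean of \<open>limit_control b S n r\<close>
  under \<open>\<pi>\<close>, and its mean would decrease linearly below 0.

  (ii) While the coordinate \<open>r\<close> is at least \<open>k\<close>, the coordinates in \<open>S\<close> dominate the process with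
  \<open>r\<close> frozen at \<open>k\<close>, which for large \<open>k\<close> still gives \<open>r\<close> a positive drift. The argument of the maximal
  ergodic lemma then yields a positive probability of never falling below \<open>k\<close>; as a function of the
  initial state, this probability is subharmonic, hence harmonic on the support of a stationary
  distribution, which is impossible as it vanishes below level \<open>k\<close>.\<close>


subsection \<open>Uniformization\<close>

lemma filterlim_const_over_Suc_at_right:
  fixes t :: real
  assumes "0 < t"
  shows "filterlim (\<lambda>n. t / real (Suc n)) (at 0 within {0..}) sequentially"
  unfolding filterlim_at
proof
  show "(\<lambda>n. t / real (Suc n)) \<longlonglongrightarrow> 0"
    using LIMSEQ_Suc[OF lim_const_over_n[of t]] .
qed (use assms in auto)

text \<open>The kernel \<open>k\<close> is the identity plus the generator divided by
  \<open>\<Lambda>\<close>: one jump of a chain whose jump times form a Poisson process of rate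
  \<open>\<Lambda>\<close>.\<close>

locale uniformized =
  fixes E :: "'a set" and q :: "'a \<Rightarrow> 'a \<Rightarrow> real" and \<Lambda> :: real and k :: "'a \<Rightarrow> 'a pmf"
  assumes \<Lambda>_pos: "0 < \<Lambda>"
    and pmf_k: "\<And>x y. x \<in> E \<Longrightarrow> y \<in> E \<Longrightarrow>
      pmf (k x) y = (if x = y then 1 else 0) + generator E q x y / \<Lambda>"
    and set_k: "\<And>x. x \<in> E \<Longrightarrow> set_pmf (k x) \<subseteq> E"
begin

lemma generator_ge:
  assumes "x \<in> E" shows "- \<Lambda> \<le> generator E q x x"
proof -
  have "0 \<le> 1 + generator E q x x / \<Lambda>"
    using pmf_k[OF assms assms] pmf_nonneg[of "k x" x] by simp
  then show ?thesis using \<Lambda>_pos by (simp add: field_simps)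
qed

lemma semigroup_derivative:
  assumes "markov_semigroup E q P" "x \<in> E" "y \<in> E"
  shows "((\<lambda>s. (pmf (P s x) y - (if x = y then 1 else 0)) / s) \<longlongrightarrow> generator E q x y)
    (at 0 within {0..})"
proof -
  have "((\<lambda>s. (pmf (P s x) y - pmf (P 0 x) y) / (s - 0)) \<longlongrightarrow> generator E q x y) (at 0 within {0..})"
    using assms unfolding markov_semigroup_def has_field_derivative_iff by blast
  moreover have "pmf (P 0 x) y = (if x = y then 1 else 0)"
    using assms by (simp add: markov_semigroup_def)
  ultimately show ?thesis by simp
qed

text \<open>Since \<open>P (s + t) x x \<ge> P s x x * P t x x\<close>, Bernoulli's inequality for \<open>P (t / n) x x ^ n\<close>
  turns the derivative at 0 into a bound at every time.\<close>

lemma semigroup_stay_ge: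
  assumes P: "markov_semigroup E q P" and x: "x \<in> E" and t: "0 \<le> t"
  shows "1 - \<Lambda> * t \<le> pmf (P t x) x"
proof (cases "t = 0")
  case True
  then show ?thesis using P x by (simp add: markov_semigroup_def)
next
  case False
  then have t: "0 < t" using t by simp
  define \<phi> where "\<phi> s = pmf (P s x) x" for s
  have super: "\<phi> s * \<phi> u \<le> \<phi> (s + u)" if "0 \<le> s" "0 \<le> u" for s u
  proof -
    have "\<phi> (s + u) = (\<integral>y. pmf (P u y) x \<partial>P s x)"
      using P x that by (simp add: \<phi>_def markov_semigroup_def pmf_bind)
    also have "\<dots> \<ge> (\<integral>y. \<phi> u * indicator {x} y \<partial>P s x)"
      by (intro integral_mono measure_pmf.integrable_const_bound[where B = 1])
        (auto simp: \<phi>_def indicator_def pmf_le_1)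
    also have "(\<integral>y. \<phi> u * indicator {x} y \<partial>P s x) = \<phi> s * \<phi> u"
      by (simp add: \<phi>_def measure_pmf_single)
    finally show ?thesis .
  qed
  have pow: "\<phi> s ^ n \<le> \<phi> (real n * s)" if "0 \<le> s" for s n
  proof (induction n)
    case 0
    then show ?case using P x by (simp add: \<phi>_def markov_semigroup_def)
  next
    case (Suc n)
    have "\<phi> s ^ Suc n \<le> \<phi> s * \<phi> (real n * s)"
      using Suc by (simp add: \<phi>_def mult_left_mono)
    also have "\<dots> \<le> \<phi> (real (Suc n) * s)"
      using super[of s "real n * s"] that by (simp add: algebra_simps)
    finally show ?case .
  qed
  have \<phi>0: "\<phi> 0 = 1" using P x by (simp add: \<phi>_def markov_semigroup_def)
  have bern: "1 + real (Suc n) * (\<phi> (t / Suc n) - 1) \<le> \<phi> t" for n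
  proof -
    have "1 + real (Suc n) * (\<phi> (t / Suc n) - 1) \<le> (1 + (\<phi> (t / Suc n) - 1)) ^ Suc n"
      by (intro Bernoulli_inequality) (simp add: \<phi>_def)
    also have "\<dots> \<le> \<phi> (real (Suc n) * (t / Suc n))"
      using pow[of "t / Suc n" "Suc n"] t by simp
    finally show ?thesis by simp
  qed
  have der: "((\<lambda>s. (\<phi> s - \<phi> 0) / s) \<longlongrightarrow> generator E q x x) (at 0 within {0..})"
    using semigroup_derivative[OF P x x] \<phi>0 by (simp add: \<phi>_def)
  have lim: "filterlim (\<lambda>n. t / real (Suc n)) (at 0 within {0..}) sequentially"
    using t by (rule filterlim_const_over_Suc_at_right)
  have "(\<lambda>n. (\<phi> (t / Suc n) - \<phi> 0) / (t / Suc n)) \<longlonglongrightarrow> generator E q x x"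
    using filterlim_compose[OF der lim] by simp
  then have "(\<lambda>n. 1 + t * ((\<phi> (t / Suc n) - \<phi> 0) / (t / Suc n))) \<longlonglongrightarrow> 1 + t * generator E q x x"
    by (intro tendsto_intros)
  moreover have "t * ((\<phi> (t / Suc n) - \<phi> 0) / (t / Suc n)) = real (Suc n) * (\<phi> (t / Suc n) - 1)" for n
    using t \<phi>0 by (simp del: of_nat_Suc)
  ultimately have "(\<lambda>n. 1 + real (Suc n) * (\<phi> (t / Suc n) - 1)) \<longlonglongrightarrow> 1 + t * generator E q x x"
    by simp
  then have "1 + t * generator E q x x \<le> \<phi> t"
    using bern by (intro LIMSEQ_le_const2) auto
  moreover have "t * (- \<Lambda>) \<le> t * generator E q x x"
    using generator_ge[OF x] t by (intro mult_left_mono) auto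
  ultimately show ?thesis by (simp add: \<phi>_def mult.commute)
qed

text \<open>Mass found in another state has left \<open>x\<close>, so the bound on staying controls
  every entry. It supplies the constant majorant for differentiating at time 0 under an
  integral.\<close>

lemma semigroup_increment_bound:
  assumes P: "markov_semigroup E q P" and x: "x \<in> E" and t: "0 \<le> t"
  shows "\<bar>pmf (P t x) y - (if x = y then 1 else 0)\<bar> \<le> \<Lambda> * t"
proof (cases "x = y")
  case True
  then show ?thesis using semigroup_stay_ge[OF assms] pmf_le_1[of "P t x" x] by simp
next
  case False
  have "pmf (P t x) x + pmf (P t x) y = measure (P t x) {x, y}"
    using False by (subst measure_measure_pmf_finite) auto
  also have "\<dots> \<le> 1" by simp
  finally show ?thesis using semigroup_stay_ge[OF assms] False by simp
qed

text \<open>The equation for \<open>\<pi>\<close> and \<open>P t\<close> is differentiated at time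
  0. The difference quotients are bounded by \<open>\<Lambda>\<close> uniformly in the initial
  state, so dominated convergence turns the pointwise derivatives into a generator that integrates
  to 0.\<close>

lemma stationary_distribution_imp_bind_eq:
  assumes "stationary_distribution E q \<pi>"
  shows "bind_pmf \<pi> k = \<pi>"
proof (rule pmf_eqI)
  fix y
  from assms obtain P where \<pi>: "set_pmf \<pi> \<subseteq> E" and P: "markov_semigroup E q P"
    and inv: "\<And>t. 0 \<le> t \<Longrightarrow> bind_pmf \<pi> (P t) = \<pi>"
    by (auto simp: stationary_distribution_def)
  show "pmf (bind_pmf \<pi> k) y = pmf \<pi> y"
  proof (cases "y \<in> E")
    case False
    then have "y \<notin> set_pmf (bind_pmf \<pi> k)" "y \<notin> set_pmf \<pi>" using \<pi> set_k by auto
    then show ?thesis by (metis pmf_eq_0_set_pmf)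
  next
    case y: True
    define \<delta> where "\<delta> x = (if x = y then 1 else 0 :: real)" for x
    define h where "h n = 1 / real (Suc n)" for n
    define u where "u n x = (pmf (P (h n) x) y - \<delta> x) / h n" for n x
    have h: "0 < h n" for n by (simp add: h_def)
    have \<delta>: "(\<integral>x. \<delta> x \<partial>\<pi>) = pmf \<pi> y"
    proof -
      have "\<delta> = indicator {y}" by (auto simp: \<delta>_def)
      then show ?thesis by (simp add: measure_pmf_single)
    qed
    have int\<delta>: "integrable \<pi> \<delta>"
      by (rule measure_pmf.integrable_const_bound[where B = 1]) (auto simp: \<delta>_def)
    have zero: "(\<integral>x. u n x \<partial>\<pi>) = 0" for n
    proof -
      have "(\<integral>x. u n x \<partial>\<pi>) = ((\<integral>x. pmf (P (h n) x) y \<partial>\<pi>) - (\<integral>x. \<delta> x \<partial>\<pi>)) / h n"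
        unfolding u_def using int\<delta>
        by (simp, subst Bochner_Integration.integral_diff)
          (auto intro!: measure_pmf.integrable_const_bound[where B = 1] simp: pmf_le_1)
      also have "\<dots> = 0"
        using inv[of "h n"] h[of n] by (simp add: \<delta> pmf_bind[symmetric] less_imp_le)
      finally show ?thesis .
    qed
    have "(\<lambda>n. \<integral>x. u n x \<partial>\<pi>) \<longlonglongrightarrow> (\<integral>x. generator E q x y \<partial>\<pi>)"
    proof (rule integral_dominated_convergence[where w = "\<lambda>_. \<Lambda>"])
      show "AE x in \<pi>. (\<lambda>n. u n x) \<longlonglongrightarrow> generator E q x y"
      proof (rule AE_pmfI)
        fix x assume "x \<in> set_pmf \<pi>"
        then have x: "x \<in> E" using \<pi> by auto
        have "((\<lambda>s. (pmf (P s x) y - \<delta> x) / s) \<longlongrightarrow> generator E q x y) (at 0 within {0..})"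
          using semigroup_derivative[OF P x y] by (simp add: \<delta>_def)
        moreover have "filterlim h (at 0 within {0..}) sequentially"
          unfolding h_def by (rule filterlim_const_over_Suc_at_right) simp
        ultimately show "(\<lambda>n. u n x) \<longlonglongrightarrow> generator E q x y"
          unfolding u_def by (rule filterlim_compose)
      qed
      show "AE x in \<pi>. norm (u n x) \<le> \<Lambda>" for n
      proof (rule AE_pmfI)
        fix x assume "x \<in> set_pmf \<pi>"
        then have "\<bar>pmf (P (h n) x) y - \<delta> x\<bar> \<le> \<Lambda> * h n"
          using semigroup_increment_bound[OF P, of x "h n" y] h[of n] \<pi> by (auto simp: \<delta>_def)
        then show "norm (u n x) \<le> \<Lambda>" using h[of n] by (simp add: u_def pos_divide_le_eq)
      qed
    qed auto
    then have gen0: "(\<integral>x. generator E q x y \<partial>\<pi>) = 0"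
      by (simp add: zero LIMSEQ_const_iff)
    have gen_eq: "AE x in \<pi>. generator E q x y = \<Lambda> * (pmf (k x) y - \<delta> x)"
      using \<pi> y pmf_k \<Lambda>_pos by (intro AE_pmfI) (auto simp: \<delta>_def)
    have "0 = (\<integral>x. \<Lambda> * (pmf (k x) y - \<delta> x) \<partial>\<pi>)"
      using gen0 integral_cong_AE[OF _ _ gen_eq] by simp
    also have "\<dots> = \<Lambda> * ((\<integral>x. pmf (k x) y \<partial>\<pi>) - (\<integral>x. \<delta> x \<partial>\<pi>))"
      using int\<delta> by (simp, subst Bochner_Integration.integral_diff)
        (auto intro!: measure_pmf.integrable_const_bound[where B = 1] simp: pmf_le_1)
    finally show ?thesis using \<Lambda>_pos by (simp add: \<delta> pmf_bind)
  qed
qed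

end

section \<open>The semigroup as a Poisson mixture of powers of the kernel. The rate 0 is a separate
  case because the mixture is also needed at time 0\<close>

definition poisson0_pmf :: "real \<Rightarrow> nat pmf" where
  "poisson0_pmf r = (if r = 0 then return_pmf 0 else poisson_pmf r)"

lemma pmf_poisson0: "0 \<le> r \<Longrightarrow> pmf (poisson0_pmf r) n = r ^ n / fact n * exp (- r)"
  by (auto simp: poisson0_pmf_def power_0_left)

lemma poisson0_pmf_add:
  assumes "0 \<le> r" "0 \<le> s"
  shows "bind_pmf (poisson0_pmf r) (\<lambda>m. map_pmf ((+) m) (poisson0_pmf s)) = poisson0_pmf (r + s)"
proof (rule pmf_eqI)
  fix N
  have pm: "pmf (map_pmf ((+) m) (poisson0_pmf s)) N =
      (if m \<le> N then pmf (poisson0_pmf s) (N - m) else 0)" for m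
  proof (cases "m \<le> N")
    case True
    then show ?thesis
      using pmf_map_inj'[of "(+) m" "poisson0_pmf s" "N - m"] by simp
  next
    case False
    then have "N \<notin> set_pmf (map_pmf ((+) m) (poisson0_pmf s))" by auto
    then show ?thesis using False by (metis pmf_eq_0_set_pmf)
  qed
  have "pmf (bind_pmf (poisson0_pmf r) (\<lambda>m. map_pmf ((+) m) (poisson0_pmf s))) N =
      (\<Sum>m\<le>N. (if m \<le> N then pmf (poisson0_pmf s) (N - m) else 0) * pmf (poisson0_pmf r) m)"
    unfolding pmf_bind pm by (rule integral_measure_pmf_real) (auto split: if_splits)
  also have "\<dots> = (\<Sum>m\<le>N. (r ^ m /\<^sub>R fact m) * (s ^ (N - m) /\<^sub>R fact (N - m))) * exp (- (r + s))"
    unfolding sum_distrib_right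
    by (intro sum.cong) (use assms in \<open>auto simp: pmf_poisson0 divide_inverse exp_add exp_minus exp_diff ac_simps\<close>)
  also have "\<dots> = (r + s) ^ N / fact N * exp (- (r + s))"
    by (subst exp_series_add_commuting[symmetric]) (auto simp: divide_inverse)
  finally show "pmf (bind_pmf (poisson0_pmf r) (\<lambda>m. map_pmf ((+) m) (poisson0_pmf s))) N =
      pmf (poisson0_pmf (r + s)) N"
    using assms by (simp add: pmf_poisson0)
qed

text \<open>The error is at most the probability of two or more events, which is of second order in
  the rate; hence only the first two terms count for the derivative at 0.\<close>

lemma expectation_poisson0_approx:
  assumes r: "0 \<le> r" and c: "\<And>n. 0 \<le> c n" "\<And>n. c n \<le> (1 :: real)"
  shows "\<bar>(\<integral>n. c n \<partial>poisson0_pmf r) - (c 0 * exp (- r) + c 1 * (r * exp (- r)))\<bar>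
    \<le> 1 - exp (- r) * (1 + r)"
proof -
  let ?p = "poisson0_pmf r"
  have int: "integrable ?p g" if "\<And>n. \<bar>g n\<bar> \<le> 1" for g :: "nat \<Rightarrow> real"
    using that by (intro measure_pmf.integrable_const_bound[where B = 1]) auto
  have split: "(\<integral>n. g n \<partial>?p) = g 0 * exp (- r) + g 1 * (r * exp (- r))
      + (\<integral>n. (if n < 2 then 0 else g n) \<partial>?p)" if g: "\<And>n. \<bar>g n\<bar> \<le> 1" for g :: "nat \<Rightarrow> real"
  proof -
    have "(\<integral>n. g n \<partial>?p) = (\<integral>n. (if n < 2 then g n else 0) + (if n < 2 then 0 else g n) \<partial>?p)"
      by (intro Bochner_Integration.integral_cong) auto
    also have "\<dots> = (\<integral>n. (if n < 2 then g n else 0) \<partial>?p) + (\<integral>n. (if n < 2 then 0 else g n) \<partial>?p)"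
      by (intro Bochner_Integration.integral_add int) (use g in auto)
    also have "(\<integral>n. (if n < 2 then g n else 0) \<partial>?p) = (\<Sum>n\<in>{0, 1}. (if n < 2 then g n else 0) * pmf ?p n)"
      by (intro integral_measure_pmf_real) (auto split: if_splits)
    also have "\<dots> = g 0 * exp (- r) + g 1 * (r * exp (- r))"
      using r by (simp add: pmf_poisson0)
    finally show ?thesis .
  qed
  define a where "a = (\<integral>n. (if n < 2 then 0 else c n) \<partial>?p)"
  define e where "e = (\<integral>n. (if n < 2 then 0 else 1 :: real) \<partial>?p)"
  have "a \<le> e" unfolding a_def e_def by (intro integral_mono int) (use c in auto)
  moreover have "0 \<le> a" unfolding a_def by (intro integral_nonneg_AE) (use c in auto)
  moreover have "e = 1 - exp (- r) * (1 + r)"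
    using split[of "\<lambda>_. 1"] by (simp add: e_def algebra_simps)
  ultimately show ?thesis using split[of c] c by (simp add: a_def)
qed

context uniformized
begin

primrec kpow :: "nat \<Rightarrow> 'a \<Rightarrow> 'a pmf" where
  "kpow 0 x = return_pmf x"
| "kpow (Suc n) x = bind_pmf (kpow n x) k"

lemma kpow_add: "kpow (m + n) x = bind_pmf (kpow m x) (kpow n)"
  by (induction n) (auto simp: bind_return_pmf' bind_assoc_pmf)

lemma set_kpow: "x \<in> E \<Longrightarrow> set_pmf (kpow n x) \<subseteq> E"
  by (induction n) (use set_k in auto)

text \<open>This is the chain \<open>k\<close> run by a Poisson clock of rate
  \<open>\<Lambda>\<close>. The semigroup law combines the convolution of Poisson laws with
  \<open>kpow_add\<close>.\<close>

lemma markov_semigroup_poisson: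
  "markov_semigroup E q (\<lambda>t x. bind_pmf (poisson0_pmf (\<Lambda> * t)) (\<lambda>n. kpow n x))"
  unfolding markov_semigroup_def
proof (intro conjI allI impI ballI)
  fix t :: real and x assume "x \<in> E"
  then show "set_pmf (bind_pmf (poisson0_pmf (\<Lambda> * t)) (\<lambda>n. kpow n x)) \<subseteq> E"
    using set_kpow by auto
next
  fix x show "bind_pmf (poisson0_pmf (\<Lambda> * 0)) (\<lambda>n. kpow n x) = return_pmf x"
    by (simp add: poisson0_pmf_def bind_return_pmf)
next
  fix s t :: real and x assume st: "0 \<le> s" "0 \<le> t"
  have "bind_pmf (poisson0_pmf (\<Lambda> * (s + t))) (\<lambda>n. kpow n x) =
      bind_pmf (bind_pmf (poisson0_pmf (\<Lambda> * s)) (\<lambda>m. map_pmf ((+) m) (poisson0_pmf (\<Lambda> * t)))) (\<lambda>n. kpow n x)"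
    using st \<Lambda>_pos by (simp add: poisson0_pmf_add distrib_left)
  also have "\<dots> = bind_pmf (poisson0_pmf (\<Lambda> * s)) (\<lambda>m. bind_pmf (poisson0_pmf (\<Lambda> * t))
      (\<lambda>n. bind_pmf (kpow m x) (kpow n)))"
    by (simp add: bind_assoc_pmf bind_map_pmf kpow_add)
  also have "\<dots> = bind_pmf (poisson0_pmf (\<Lambda> * s)) (\<lambda>m. bind_pmf (kpow m x)
      (\<lambda>y. bind_pmf (poisson0_pmf (\<Lambda> * t)) (\<lambda>n. kpow n y)))"
    by (subst bind_commute_pmf) simp
  finally show "bind_pmf (poisson0_pmf (\<Lambda> * (s + t))) (\<lambda>n. kpow n x) =
      bind_pmf (bind_pmf (poisson0_pmf (\<Lambda> * s)) (\<lambda>n. kpow n x))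
        (\<lambda>y. bind_pmf (poisson0_pmf (\<Lambda> * t)) (\<lambda>n. kpow n y))"
    by (simp add: bind_assoc_pmf)
next
  fix x y assume xy: "x \<in> E" "y \<in> E"
  define c where "c n = pmf (kpow n x) y" for n
  define f where "f t = pmf (bind_pmf (poisson0_pmf (\<Lambda> * t)) (\<lambda>n. kpow n x)) y" for t
  \<comment> \<open>\<open>g\<close> collects the contributions of no jump and of one jump;
    \<open>h\<close> is the probability of at least two jumps and has derivative 0 at time
    0.\<close>
  define g where "g t = c 0 * exp (- (\<Lambda> * t)) + c 1 * (\<Lambda> * t * exp (- (\<Lambda> * t)))" for t
  define h where "h t = 1 - exp (- (\<Lambda> * t)) * (1 + \<Lambda> * t)" for t
  have bound: "\<bar>f t - g t\<bar> \<le> h t" if "0 \<le> t" for t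
    using expectation_poisson0_approx[of "\<Lambda> * t" c] that \<Lambda>_pos
    by (simp add: f_def g_def h_def c_def pmf_bind pmf_le_1)
  have dg: "(g has_real_derivative \<Lambda> * (c 1 - c 0)) (at 0 within {0..})"
    unfolding g_def by (auto intro!: derivative_eq_intros simp: algebra_simps)
  have "(h has_real_derivative 0) (at 0 within {0..})"
    unfolding h_def by (auto intro!: derivative_eq_intros)
  then have dh: "((\<lambda>t. h t / t) \<longlongrightarrow> 0) (at 0 within {0..})"
    by (simp add: has_field_derivative_iff h_def)
  have "((\<lambda>t. (f t - g t) / t) \<longlongrightarrow> 0) (at 0 within {0..})"
  proof (rule Lim_null_comparison[OF _ dh])
    show "\<forall>\<^sub>F t in at 0 within {0..}. norm ((f t - g t) / t) \<le> h t / t"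
      unfolding eventually_at_filter
      by (intro always_eventually) (auto simp: bound divide_right_mono)
  qed
  moreover have f0: "f 0 - g 0 = 0" using bound[of 0] by (simp add: h_def)
  ultimately have "((\<lambda>t. f t - g t) has_real_derivative 0) (at 0 within {0..})"
    by (simp add: has_field_derivative_iff)
  from DERIV_add[OF this dg] have "(f has_real_derivative \<Lambda> * (c 1 - c 0)) (at 0 within {0..})"
    by simp
  moreover have "\<Lambda> * (c 1 - c 0) = generator E q x y"
    using pmf_k[OF xy] \<Lambda>_pos by (simp add: c_def bind_return_pmf field_simps)
  ultimately show "((\<lambda>t. pmf (bind_pmf (poisson0_pmf (\<Lambda> * t)) (\<lambda>n. kpow n x)) y)
      has_real_derivative generator E q x y) (at 0 within {0..})"
    by (simp add: f_def[abs_def])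
qed

lemma bind_eq_imp_stationary_distribution:
  assumes \<pi>: "set_pmf \<pi> \<subseteq> E" and inv: "bind_pmf \<pi> k = \<pi>"
  shows "stationary_distribution E q \<pi>"
proof -
  have "bind_pmf \<pi> (kpow n) = \<pi>" for n
  proof (induction n)
    case (Suc n)
    have "bind_pmf \<pi> (kpow (Suc n)) = bind_pmf (bind_pmf \<pi> (kpow n)) k"
      by (simp add: bind_assoc_pmf[symmetric] kpow.simps(2)[abs_def])
    then show ?case using Suc inv by (simp only:)
  qed (simp add: bind_return_pmf')
  then have "bind_pmf \<pi> (\<lambda>x. bind_pmf (poisson0_pmf (\<Lambda> * t)) (\<lambda>n. kpow n x)) = \<pi>" for t
    by (subst bind_commute_pmf) simp
  then show ?thesis
    using \<pi> markov_semigroup_poisson by (auto simp: stationary_distribution_def)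
qed

end


subsection \<open>Limits of monotonic controls\<close>

text \<open>A diagonal path to infinity: all coordinates outside \<open>A\<close> share the value
  \<open>k\<close>. By monotonicity the limits along \<open>to_infinity_outside\<close> can be
  computed along it.\<close>

definition keep :: "'r set \<Rightarrow> ('r \<Rightarrow> nat) \<Rightarrow> nat \<Rightarrow> 'r \<Rightarrow> nat" where
  "keep A n k = (\<lambda>s. if s \<in> A then n s else k)"

text \<open>As there are finitely many coordinates, the thresholds of the single coordinates have a
  common maximum \<open>K\<close>. With the converse below, this describes the filter by explicit
  basic sets.\<close>

lemma eventually_to_infinity_outside:
  fixes A :: "'r::finite set"
  assumes "eventually P (to_infinity_outside A n)"
  shows "\<exists>K. \<forall>m. (\<forall>s\<in>A. m s = n s) \<and> (\<forall>s. s \<notin> A \<longrightarrow> K \<le> m s) \<longrightarrow> P m"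
proof -
  let ?G = "\<lambda>s. filtercomap (\<lambda>m. m s) (if s \<in> A then principal {n s} else at_top :: nat filter)"
  from assms obtain Q where Q: "\<forall>s. eventually (Q s) (?G s)"
    and P: "\<forall>m. (\<forall>s. Q s m) \<longrightarrow> P m"
    unfolding to_infinity_outside_def
    by (subst (asm) eventually_INF_finite) auto
  have "\<exists>K. \<forall>m. (s \<in> A \<longrightarrow> m s = n s) \<and> (s \<notin> A \<longrightarrow> K \<le> m s) \<longrightarrow> Q s m" for s
  proof (cases "s \<in> A")
    case True
    then have "eventually (Q s) (filtercomap (\<lambda>m. m s) (principal {n s}))"
      using Q by (metis (full_types))
    then show ?thesis using True by (auto simp: eventually_filtercomap eventually_principal)
  next
    case False
    then have "eventually (Q s) (filtercomap (\<lambda>m. m s) at_top)"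
      using Q by (metis (full_types))
    then show ?thesis using False
      by (auto simp: eventually_filtercomap eventually_at_top_linorder)
  qed
  then obtain K where K: "\<And>s m. (s \<in> A \<longrightarrow> m s = n s) \<and> (s \<notin> A \<longrightarrow> K s \<le> m s) \<longrightarrow> Q s m"
    by metis
  have "\<forall>m. (\<forall>s\<in>A. m s = n s) \<and> (\<forall>s. s \<notin> A \<longrightarrow> Max (range K) \<le> m s) \<longrightarrow> P m"
  proof (intro allI impI)
    fix m assume m: "(\<forall>s\<in>A. m s = n s) \<and> (\<forall>s. s \<notin> A \<longrightarrow> Max (range K) \<le> m s)"
    have "K s \<le> m s" if "s \<notin> A" for s
      using m that Max_ge[of "range K" "K s"] by (meson finite finite_imageI le_trans rangeI)
    then show "P m" using P K m by metis
  qed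
  then show ?thesis by blast
qed

lemma eventually_to_infinity_outsideI:
  fixes A :: "'r::finite set"
  assumes "\<And>m. (\<And>s. s \<in> A \<Longrightarrow> m s = n s) \<Longrightarrow> (\<And>s. s \<notin> A \<Longrightarrow> K \<le> m s) \<Longrightarrow> P m"
  shows "eventually P (to_infinity_outside A n)"
proof -
  have "\<forall>s. eventually (\<lambda>m. if s \<in> A then m s = n s else K \<le> m s)
      (filtercomap (\<lambda>m. m s) (if s \<in> A then principal {n s} else at_top))"
    (is "\<forall>s. eventually (?Q s) (?G s)")
  proof
    fix s show "eventually (?Q s) (?G s)"
      by (cases "s \<in> A")
        (auto simp: eventually_principal intro!: eventually_filtercomapI[where P = "\<lambda>k. if s \<in> A then k = n s else K \<le> k"])
  qed
  moreover have "P m" if "\<forall>s. if s \<in> A then m s = n s else K \<le> m s" for m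
    using that by (intro assms) (metis (full_types))+
  ultimately show ?thesis
    unfolding to_infinity_outside_def
    by (subst eventually_INF_finite) (simp, rule exI[of _ ?Q], simp)
qed

lemma to_infinity_outside_neq_bot:
  fixes A :: "'r::finite set"
  shows "to_infinity_outside A n \<noteq> bot"
proof
  assume "to_infinity_outside A n = bot"
  then have "eventually (\<lambda>_. False) (to_infinity_outside A n)" by simp
  from eventually_to_infinity_outside[OF this] obtain K where
    "\<forall>m. \<not> ((\<forall>s\<in>A. m s = n s) \<and> (\<forall>s. s \<notin> A \<longrightarrow> K \<le> m s))" by auto
  from spec[OF this, of "keep A n K"] show False by (simp add: keep_def)
qed

text \<open>The coordinates other than \<open>r\<close> are raised from \<open>n\<close> to
  \<open>m\<close> one at a time; \<open>D\<close> holds those already raised.\<close>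

lemma monotonic_control_antimono:
  fixes b :: "('r::finite \<Rightarrow> nat) \<Rightarrow> 'r \<Rightarrow> real"
  assumes "monotonic_control b" "n \<le> m" "n r = m r"
  shows "b m r \<le> b n r"
proof -
  have "r \<notin> D \<Longrightarrow> b (\<lambda>s. if s \<in> D then m s else n s) r \<le> b n r" if "finite D" for D
    using that
  proof (induction D)
    case (insert x D)
    let ?n = "\<lambda>s. if s \<in> D then m s else n s"
    have "antimono (\<lambda>k. b (?n(x := k)) r)"
      using assms(1) insert.prems by (auto simp: monotonic_control_def)
    then have "b (?n(x := m x)) r \<le> b (?n(x := n x)) r"
      using assms(2) by (intro antimonoD[of "\<lambda>k. b (?n(x := k)) r"]) (auto simp: le_fun_def)
    moreover have "?n(x := n x) = ?n" using insert.hyps by auto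
    moreover have "?n(x := m x) = (\<lambda>s. if s \<in> insert x D then m s else n s)" by auto
    ultimately show ?case using insert by auto
  qed simp
  from this[of "UNIV - {r}"] have "b (\<lambda>s. if s \<noteq> r then m s else n s) r \<le> b n r" by simp
  moreover have "(\<lambda>s. if s \<noteq> r then m s else n s) = m" using assms(3) by auto
  ultimately show ?thesis by simp
qed

text \<open>The diagonal values decrease, and \<open>b m r\<close> is squeezed between two of them:
  one at a level below all coordinates of \<open>m\<close> outside \<open>A\<close>, one at the
  level \<open>Max (range m)\<close>.\<close>

lemma tendsto_limit_control_keep:
  fixes b :: "('r::finite \<Rightarrow> nat) \<Rightarrow> 'r \<Rightarrow> real"
  assumes b: "monotonic_control b" and r: "r \<in> A"
  shows "(\<lambda>k. b (keep A n k) r) \<longlonglongrightarrow> limit_control b A n r"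
    and "limit_control b A n r \<le> b (keep A n k) r"
proof -
  define a where "a k = b (keep A n k) r" for k
  have a_dec: "decseq a"
    unfolding decseq_def a_def using r
    by (auto intro!: monotonic_control_antimono[OF b] simp: keep_def le_fun_def)
  have a0: "0 \<le> a k" for k
    using b by (auto simp: a_def monotonic_control_def bounded_control_def control_def)
  obtain L where L: "a \<longlonglongrightarrow> L" "\<And>k. L \<le> a k"
    using decseq_convergent[OF a_dec, of 0] a0 by metis
  have "((\<lambda>m. b m r) \<longlongrightarrow> L) (to_infinity_outside A n)"
  proof (rule tendstoI)
    fix e :: real assume "e > 0"
    then obtain K where K: "a K < L + e"
      using order_tendstoD(2)[OF L(1), of "L + e"] by (auto simp: eventually_sequentially)
    show "eventually (\<lambda>m. dist (b m r) L < e) (to_infinity_outside A n)"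
    proof (rule eventually_to_infinity_outsideI)
      fix m assume m: "\<And>s. s \<in> A \<Longrightarrow> m s = n s" "\<And>s. s \<notin> A \<Longrightarrow> K \<le> m s"
      have "b m r \<le> a K"
        unfolding a_def using m r
        by (intro monotonic_control_antimono[OF b]) (auto simp: keep_def le_fun_def)
      moreover have "a (Max (range m)) \<le> b m r"
        unfolding a_def using m r
        by (intro monotonic_control_antimono[OF b]) (auto simp: keep_def le_fun_def)
      ultimately show "dist (b m r) L < e" using K L(2)[of "Max (range m)"]
        by (auto simp: dist_real_def)
    qed
  qed
  then have "limit_control b A n r = L"
    using r by (simp add: limit_control_def tendsto_Lim[OF to_infinity_outside_neq_bot])
  then show "(\<lambda>k. b (keep A n k) r) \<longlonglongrightarrow> limit_control b A n r"
    and "limit_control b A n r \<le> b (keep A n k) r"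
    using L by (auto simp: a_def[abs_def])
qed

context
  fixes b :: "('r::finite \<Rightarrow> nat) \<Rightarrow> 'r \<Rightarrow> real" and B :: real
  assumes b: "monotonic_control b" and B: "\<And>n r. b n r \<le> B"
begin

lemma limit_control_cong:
  assumes "r \<in> A" "\<And>s. s \<in> A \<Longrightarrow> n s = m s"
  shows "limit_control b A n r = limit_control b A m r"
proof -
  have "keep A n = keep A m" using assms(2) by (auto simp: keep_def fun_eq_iff)
  then show ?thesis
    using tendsto_limit_control_keep(1)[OF b assms(1), of n]
      tendsto_limit_control_keep(1)[OF b assms(1), of m] by (metis LIMSEQ_unique)
qed

lemma limit_control_nonneg:
  assumes "r \<in> A" shows "0 \<le> limit_control b A n r"
  using b by (intro LIMSEQ_le_const[OF tendsto_limit_control_keep(1)[OF b assms]])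
    (auto simp: monotonic_control_def bounded_control_def control_def)

lemma limit_control_le:
  assumes "r \<in> A" shows "limit_control b A n r \<le> B"
  using tendsto_limit_control_keep(2)[OF b assms, of n 0] B order.trans by blast

lemma limit_control_zero:
  assumes "r \<in> A" "n r = 0" shows "limit_control b A n r = 0"
proof -
  have "b (keep A n 0) r = 0"
    using b assms by (auto simp: monotonic_control_def bounded_control_def control_def keep_def)
  then show ?thesis
    using tendsto_limit_control_keep(2)[OF b assms(1), of n 0] limit_control_nonneg[OF assms(1), of n]
    by simp
qed

lemma limit_control_antimono:
  assumes "r \<in> A" "n \<le> m" "n r = m r"
  shows "limit_control b A m r \<le> limit_control b A n r"
proof (rule LIMSEQ_le[OF tendsto_limit_control_keep(1)[OF b assms(1)]
        tendsto_limit_control_keep(1)[OF b assms(1)]], intro exI[of _ 0] allI impI)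
  show "b (keep A m k) r \<le> b (keep A n k) r" for k
    using assms by (intro monotonic_control_antimono[OF b]) (auto simp: keep_def le_fun_def)
qed

lemma limit_control_mono_own:
  assumes "r \<in> A" "j \<le> k"
  shows "limit_control b A (n(r := j)) r \<le> limit_control b A (n(r := k)) r"
proof (rule LIMSEQ_le[OF tendsto_limit_control_keep(1)[OF b assms(1)]
        tendsto_limit_control_keep(1)[OF b assms(1)]], intro exI[of _ 0] allI impI)
  fix i
  have "keep A (n(r := x)) i = (keep A n i)(r := x)" for x
    using assms(1) by (auto simp: keep_def)
  then show "b (keep A (n(r := j)) i) r \<le> b (keep A (n(r := k)) i) r"
    using b assms(2) by (auto simp: monotonic_control_def dest!: monoD)
qed

text \<open>The inner limit in the definition is itself the limit control of
  \<open>insert r S\<close>, which is increasing in the coordinate \<open>r\<close> and bounded by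
  \<open>B\<close>.\<close>

lemma tendsto_limit_control_outside:
  assumes "r \<notin> S"
  shows "(\<lambda>k. limit_control b (insert r S) (n(r := k)) r) \<longlonglongrightarrow> limit_control b S n r"
    and "limit_control b (insert r S) (n(r := k)) r \<le> limit_control b S n r"
proof -
  define a where "a k = limit_control b (insert r S) (n(r := k)) r" for k
  have inc: "incseq a"
    unfolding incseq_def a_def by (auto intro!: limit_control_mono_own)
  obtain L where L: "a \<longlonglongrightarrow> L" "\<And>k. a k \<le> L"
    using incseq_convergent[OF inc, of B] limit_control_le by (metis a_def insertI1)
  have "a = (\<lambda>k. Lim (to_infinity_outside (insert r S) (n(r := k))) (\<lambda>m. b m r))"
    by (simp add: a_def limit_control_def fun_eq_iff)
  then have "limit_control b S n r = Lim at_top a"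
    using assms by (simp add: limit_control_def)
  also have "\<dots> = L" by (intro tendsto_Lim L) simp
  finally have "limit_control b S n r = L" .
  with L show "(\<lambda>k. limit_control b (insert r S) (n(r := k)) r) \<longlonglongrightarrow> limit_control b S n r"
    and "limit_control b (insert r S) (n(r := k)) r \<le> limit_control b S n r"
    by (auto simp: a_def[abs_def])
qed

text \<open>A squeeze along the diagonal for \<open>S\<close>:
  \<open>keep (insert r S) (n(r := k)) k\<close> equals \<open>keep S n k\<close>, which gives an
  upper bound, and levels beyond \<open>k\<close> give the lower one.\<close>

lemma tendsto_limit_control_inside:
  assumes "r \<notin> S" "s \<in> S"
  shows "(\<lambda>k. limit_control b (insert r S) (n(r := k)) s) \<longlonglongrightarrow> limit_control b S n s"
    and "limit_control b S n s \<le> limit_control b (insert r S) (n(r := k)) s"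
proof -
  have s: "s \<in> insert r S" using assms by simp
  have lower: "limit_control b S n s \<le> limit_control b (insert r S) (n(r := k)) s" for k
  proof (rule LIMSEQ_le[OF tendsto_limit_control_keep(1)[OF b assms(2)]
        tendsto_limit_control_keep(1)[OF b s]], intro exI[of _ k] allI impI)
    fix j assume "k \<le> j"
    then show "b (keep S n j) s \<le> b (keep (insert r S) (n(r := k)) j) s"
      using assms by (intro monotonic_control_antimono[OF b]) (auto simp: keep_def le_fun_def)
  qed
  have upper: "limit_control b (insert r S) (n(r := k)) s \<le> b (keep S n k) s" for k
  proof -
    have "keep (insert r S) (n(r := k)) k = keep S n k"
      using assms by (auto simp: keep_def)
    then show ?thesis using tendsto_limit_control_keep(2)[OF b s, of "n(r := k)" k] by simp
  qed
  show "(\<lambda>k. limit_control b (insert r S) (n(r := k)) s) \<longlonglongrightarrow> limit_control b S n s"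
    using lower upper
    by (intro tendsto_sandwich[OF _ _ tendsto_const tendsto_limit_control_keep(1)[OF b assms(2)]])
      auto
  show "limit_control b S n s \<le> limit_control b (insert r S) (n(r := k)) s"
    by (rule lower)
qed

lemma limit_control_outside_bounds:
  assumes "r \<notin> S"
  shows "0 \<le> limit_control b S n r" "limit_control b S n r \<le> B"
  by (rule LIMSEQ_le_const[OF tendsto_limit_control_outside(1)[OF assms]],
      use limit_control_nonneg in blast,
      rule LIMSEQ_le_const2[OF tendsto_limit_control_outside(1)[OF assms]],
      use limit_control_le in blast)

lemma limit_control_outside_antimono:
  assumes "r \<notin> S" "n \<le> m"
  shows "limit_control b S m r \<le> limit_control b S n r"
proof (rule LIMSEQ_le[OF tendsto_limit_control_outside(1)[OF assms(1)]
        tendsto_limit_control_outside(1)[OF assms(1)]], intro exI[of _ 0] allI impI)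
  show "limit_control b (insert r S) (m(r := k)) r \<le> limit_control b (insert r S) (n(r := k)) r" for k
    using assms by (intro limit_control_antimono) (auto simp: le_fun_def)
qed

lemma limit_control_outside_upd:
  assumes "r \<notin> S" "s \<in> insert r S"
  shows "limit_control b S (n(r := k)) s = limit_control b S n s"
proof (cases "s \<in> S")
  case True
  then show ?thesis using assms by (intro limit_control_cong) auto
qed (use assms in \<open>simp add: limit_control_def\<close>)

end


subsection \<open>Birth-death processes on several coordinates\<close>

abbreviation inc :: "'r \<Rightarrow> ('r \<Rightarrow> nat) \<Rightarrow> 'r \<Rightarrow> nat" where
  "inc s n \<equiv> n(s := n s + 1)"

abbreviation dec :: "'r \<Rightarrow> ('r \<Rightarrow> nat) \<Rightarrow> 'r \<Rightarrow> nat" where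
  "dec s n \<equiv> n(s := n s - 1)"

section \<open>Two facts on discrete laws: iterated integrals and normalization\<close>

lemma integral_bind_pmf_bounded:
  fixes f :: "'a \<Rightarrow> real"
  assumes f: "\<And>x. \<bar>f x\<bar> \<le> C"
  shows "(\<integral>x. f x \<partial>bind_pmf p k) = (\<integral>x. (\<integral>y. f y \<partial>k x) \<partial>p)"
proof -
  define g where "g x = f x + C" for x
  have g: "0 \<le> g x" "\<bar>g x\<bar> \<le> 2 * C" for x using f[of x] by (auto simp: g_def)
  have intg: "integrable (measure_pmf q) g" for q :: "'a pmf"
    using g by (intro measure_pmf.integrable_const_bound[where B = "2 * C"]) auto
  have intf: "integrable (measure_pmf q) f" for q :: "'a pmf"
    using f by (intro measure_pmf.integrable_const_bound[where B = C]) auto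
  have f_le: "\<bar>\<integral>y. f y \<partial>measure_pmf q\<bar> \<le> C" for q :: "'a pmf"
  proof -
    have "\<bar>\<integral>y. f y \<partial>measure_pmf q\<bar> \<le> (\<integral>y. C \<partial>measure_pmf q)"
      using f by (intro order.trans[OF integral_abs_bound] integral_mono intf integrable_abs) auto
    then show ?thesis by simp
  qed
  have g_eq: "(\<integral>y. g y \<partial>measure_pmf q) = (\<integral>y. f y \<partial>measure_pmf q) + C" for q :: "'a pmf"
    unfolding g_def using intf by (subst Bochner_Integration.integral_add) auto
  have "(\<integral>x. g x \<partial>bind_pmf p k) = enn2real (\<integral>\<^sup>+x. g x \<partial>bind_pmf p k)"
    using g by (intro integral_eq_nn_integral) auto
  also have "(\<integral>\<^sup>+x. g x \<partial>bind_pmf p k) = (\<integral>\<^sup>+x. ennreal (\<integral>y. g y \<partial>k x) \<partial>p)"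
    unfolding nn_integral_bind_pmf using g intg by (subst nn_integral_eq_integral) auto
  also have "enn2real \<dots> = (\<integral>x. (\<integral>y. g y \<partial>k x) \<partial>p)"
    using g by (intro integral_eq_nn_integral[symmetric]) auto
  also have "\<dots> = (\<integral>x. (\<integral>y. f y \<partial>k x) \<partial>p) + C"
    unfolding g_eq using f_le
    by (subst Bochner_Integration.integral_add)
      (auto intro!: measure_pmf.integrable_const_bound[where B = C])
  finally show ?thesis by (simp add: g_eq)
qed

lemma exists_normalized_pmf:
  fixes \<rho> :: "'a \<Rightarrow> real"
  assumes nonneg: "\<And>x. 0 \<le> \<rho> x" and bound: "\<And>F. finite F \<Longrightarrow> sum \<rho> F \<le> C" and x: "0 < \<rho> x"
  shows "\<exists>p c. 0 < c \<and> (\<forall>y. pmf p y = \<rho> y / c)"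
proof -
  define c where "c = infsetsum \<rho> UNIV"
  have nn: "(\<integral>\<^sup>+y. ennreal (\<rho> y) \<partial>count_space UNIV) = ennreal c"
    unfolding c_def using bound nonneg
    by (intro nn_integral_conv_infsetsum abs_summable_finite_sumsI[where B = C]) auto
  have "ennreal (\<rho> x) \<le> ennreal c"
    unfolding nn[symmetric] by (rule nn_integral_ge_point) simp
  then have c: "0 < c" using x by (metis ennreal_le_iff2 less_le_trans not_less)
  have "(\<integral>\<^sup>+y. ennreal (\<rho> y / c) \<partial>count_space UNIV) = (\<integral>\<^sup>+y. ennreal (\<rho> y) \<partial>count_space UNIV) / ennreal c"
    using c nonneg by (subst nn_integral_divide[symmetric]) (auto simp: divide_ennreal)
  also have "\<dots> = 1" using c by (simp add: nn)
  finally have "pmf (embed_pmf (\<lambda>y. \<rho> y / c)) y = \<rho> y / c" for y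
    using c nonneg by (intro pmf_embed_pmf) auto
  then show ?thesis using c by blast
qed

text \<open>Coordinates with \<open>a s = 0\<close> are frozen, so that one type of states serves
  the processes on all subsets and those with a coordinate held fixed. The clock rates
  \<open>w\<close> are separate from the actual rates, so that different processes can be
  uniformized alike and compared.\<close>

locale birth_death =
  fixes \<Lambda> :: real and w a :: "'r::finite \<Rightarrow> real" and d :: "('r \<Rightarrow> nat) \<Rightarrow> 'r \<Rightarrow> real"
  assumes \<Lambda>_eq: "\<Lambda> = (\<Sum>s\<in>UNIV. w s)" and \<Lambda>_pos: "0 < \<Lambda>"
    and a_nonneg: "\<And>s. 0 \<le> a s" and d_nonneg: "\<And>n s. 0 \<le> d n s"
    and rate_le: "\<And>n s. a s + d n s \<le> w s"
    and d_zero: "\<And>n s. n s = 0 \<Longrightarrow> d n s = 0"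
    and d_frozen: "\<And>n s. a s = 0 \<Longrightarrow> d n s = 0"
begin

text \<open>The generator is bounded by \<open>\<Lambda>\<close>, so that \<open>step\<close> is the transition operator of the
  uniformized chain.\<close>

definition step :: "(('r \<Rightarrow> nat) \<Rightarrow> real) \<Rightarrow> ('r \<Rightarrow> nat) \<Rightarrow> real" where
  "step f n = f n +
    (\<Sum>s\<in>UNIV. a s * (f (inc s n) - f n) + d n s * (f (dec s n) - f n)) / \<Lambda>"

definition closed :: "('r \<Rightarrow> nat) set \<Rightarrow> bool" where
  "closed E \<longleftrightarrow> (\<forall>n\<in>E. \<forall>s. (a s \<noteq> 0 \<longrightarrow> inc s n \<in> E) \<and> (d n s \<noteq> 0 \<longrightarrow> dec s n \<in> E))"

lemma closed_UNIV [simp]: "closed UNIV"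
  by (simp add: closed_def)

text \<open>All weights in this form are nonnegative and they add up to \<open>\<Lambda>\<close>,
  which exhibits \<open>step\<close> as an averaging operator.\<close>

lemma step_eq:
  "step f n = (\<Sum>s\<in>UNIV. a s * f (inc s n) + d n s * f (dec s n) + (w s - a s - d n s) * f n) / \<Lambda>"
proof -
  have "(\<Sum>s\<in>UNIV. a s * f (inc s n) + d n s * f (dec s n) + (w s - a s - d n s) * f n)
      = (\<Sum>s\<in>UNIV. a s * (f (inc s n) - f n) + d n s * (f (dec s n) - f n)) + (\<Sum>s\<in>UNIV. w s) * f n"
    unfolding sum_distrib_right sum.distrib[symmetric] by (intro sum.cong) (auto simp: algebra_simps)
  then show ?thesis using \<Lambda>_pos by (simp add: step_def \<Lambda>_eq[symmetric] add_divide_distrib)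
qed

lemma step_le:
  assumes "closed E" "\<And>m. m \<in> E \<Longrightarrow> f m \<le> g m" "n \<in> E"
  shows "step f n \<le> step g n"
  unfolding step_eq
proof (intro divide_right_mono sum_mono add_mono)
  fix s
  show "a s * f (inc s n) \<le> a s * g (inc s n)"
    using assms a_nonneg[of s] by (cases "a s = 0") (auto simp: closed_def intro!: mult_left_mono)
  show "d n s * f (dec s n) \<le> d n s * g (dec s n)"
    using assms d_nonneg[of n s] by (cases "d n s = 0") (auto simp: closed_def intro!: mult_left_mono)
  show "(w s - a s - d n s) * f n \<le> (w s - a s - d n s) * g n"
    using rate_le[of s n] assms by (intro mult_left_mono) auto
qed (use \<Lambda>_pos in auto)

lemma pow_le:
  assumes "closed E" "\<And>m. m \<in> E \<Longrightarrow> f m \<le> g m" "n \<in> E"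
  shows "(step ^^ j) f n \<le> (step ^^ j) g n"
  using assms(3) by (induction j arbitrary: n) (use assms(1,2) in \<open>auto intro: step_le\<close>)

lemma step_const: "step (\<lambda>_. c) = (\<lambda>_. c)"
  by (simp add: step_def fun_eq_iff)

lemma step_add: "step (\<lambda>n. f n + g n) = (\<lambda>n. step f n + step g n)"
proof
  fix n
  have "(\<Sum>s\<in>UNIV. a s * (f (inc s n) + g (inc s n)) + d n s * (f (dec s n) + g (dec s n))
        + (w s - a s - d n s) * (f n + g n))
      = (\<Sum>s\<in>UNIV. a s * f (inc s n) + d n s * f (dec s n) + (w s - a s - d n s) * f n)
      + (\<Sum>s\<in>UNIV. a s * g (inc s n) + d n s * g (dec s n) + (w s - a s - d n s) * g n)"
    unfolding sum.distrib[symmetric] by (intro sum.cong) (auto simp: algebra_simps)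
  then show "step (\<lambda>n. f n + g n) n = step f n + step g n"
    by (simp add: step_eq add_divide_distrib)
qed

lemma step_cmult: "step (\<lambda>n. c * f n) = (\<lambda>n. c * step f n)"
proof
  fix n
  show "step (\<lambda>n. c * f n) n = c * step f n"
    unfolding step_eq times_divide_eq_right sum_distrib_left
    by (intro arg_cong[where f = "\<lambda>x. x / \<Lambda>"] sum.cong) (auto simp: algebra_simps)
qed

lemma pow_const: "(step ^^ j) (\<lambda>_. c) = (\<lambda>_. c)"
  by (induction j) (simp_all add: step_const)

lemma pow_add: "(step ^^ j) (\<lambda>n. f n + g n) = (\<lambda>n. (step ^^ j) f n + (step ^^ j) g n)"
  by (induction j) (simp_all add: step_add)

lemma pow_cmult: "(step ^^ j) (\<lambda>n. c * f n) = (\<lambda>n. c * (step ^^ j) f n)"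
  by (induction j) (simp_all add: step_cmult)

lemma pow_diff: "(step ^^ j) (\<lambda>n. f n - g n) = (\<lambda>n. (step ^^ j) f n - (step ^^ j) g n)"
  using pow_add[of j f "\<lambda>n. (- 1) * g n"] pow_cmult[of j "- 1" g] by simp

lemma pow_sum:
  assumes "finite I"
  shows "(step ^^ j) (\<lambda>n. \<Sum>i\<in>I. f i n) = (\<lambda>n. \<Sum>i\<in>I. (step ^^ j) (f i) n)"
  using assms by induction (simp_all add: pow_const pow_add)

lemma step_sum:
  assumes "finite I"
  shows "step (\<lambda>n. \<Sum>i\<in>I. f i n) = (\<lambda>n. \<Sum>i\<in>I. step (f i) n)"
  using pow_sum[OF assms, of 1 f] by simp

lemma pow_bounds:
  assumes "closed E" "\<And>m. m \<in> E \<Longrightarrow> l \<le> f m \<and> f m \<le> u" "n \<in> E"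
  shows "l \<le> (step ^^ j) f n" "(step ^^ j) f n \<le> u"
  using pow_le[OF assms(1), of "\<lambda>_. l" f n j] pow_le[OF assms(1), of f "\<lambda>_. u" n j] assms(2,3)
  by (auto simp: pow_const)

definition fibre :: "('r \<Rightarrow> nat) \<Rightarrow> ('r \<Rightarrow> nat) set" where
  "fibre z = {y. \<forall>s. a s = 0 \<longrightarrow> y s = z s}"

lemma closed_fibre: "closed (fibre z)"
  by (auto simp: closed_def fibre_def d_frozen)

text \<open>The term of the coordinate \<open>r\<close> vanishes on a function that does not depend
  on \<open>r\<close>, so only the rates of the other coordinates enter.\<close>

lemma step_indep:
  assumes "\<And>n k s. s \<noteq> r \<Longrightarrow> d (n(r := k)) s = d n s" "\<And>n k. f (n(r := k)) = f n"
  shows "step f (n(r := k)) = step f n"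
proof -
  have "a s * (f (inc s (n(r := k))) - f (n(r := k))) + d (n(r := k)) s * (f (dec s (n(r := k))) - f (n(r := k)))
      = a s * (f (inc s n) - f n) + d n s * (f (dec s n) - f n)" for s
  proof (cases "s = r")
    case True
    then show ?thesis by (simp add: assms(2))
  next
    case False
    have "f ((n(r := k))(s := v)) = f (n(s := v))" for v
      using assms(2)[of "n(s := v)" k] fun_upd_twist[OF False, of n v k] by simp
    then show ?thesis using False assms by simp
  qed
  then show ?thesis by (simp add: step_def assms(2))
qed

text \<open>Jumps are drawn as labels from a finite type, \<open>None\<close> meaning no jump, and
  mapped to states afterwards. Coinciding targets, as for \<open>dec s n = n\<close> at
  \<open>n s = 0\<close>, then cause no case distinction.\<close>

definition event :: "('r \<Rightarrow> nat) \<Rightarrow> ('r \<times> bool) option pmf" where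
  "event n = embed_pmf (\<lambda>e. case e of
      None \<Rightarrow> (\<Sum>s\<in>UNIV. w s - a s - d n s) / \<Lambda>
    | Some (s, u) \<Rightarrow> (if u then a s else d n s) / \<Lambda>)"

definition ker :: "('r \<Rightarrow> nat) \<Rightarrow> ('r \<Rightarrow> nat) pmf" where
  "ker n = map_pmf (\<lambda>e. case e of
      None \<Rightarrow> n
    | Some (s, u) \<Rightarrow> (if u then inc s n else dec s n)) (event n)"

lemma sum_event:
  "(\<Sum>e\<in>UNIV. (case e of None \<Rightarrow> x | Some (s, u) \<Rightarrow> (if u then f s else g s)))
    = x + (\<Sum>s\<in>(UNIV :: 'r set). f s + g s :: real)"
proof -
  have "(\<Sum>e\<in>UNIV. (case e of None \<Rightarrow> x | Some (s, u) \<Rightarrow> (if u then f s else g s)))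
      = x + (\<Sum>p\<in>UNIV. (case p of (s, u) \<Rightarrow> (if u then f s else g s)))"
    by (simp add: UNIV_option_conv sum.reindex)
  also have "(\<Sum>p\<in>UNIV. (case p of (s, u) \<Rightarrow> (if u then f s else g s)))
      = (\<Sum>s\<in>UNIV. \<Sum>u\<in>UNIV. (if u then f s else g s))"
    by (simp add: sum.cartesian_product)
  finally show ?thesis by (simp add: UNIV_bool add.commute)
qed

lemma pmf_event:
  "pmf (event n) e = (case e of
      None \<Rightarrow> (\<Sum>s\<in>UNIV. w s - a s - d n s) / \<Lambda>
    | Some (s, u) \<Rightarrow> (if u then a s else d n s) / \<Lambda>)"
  unfolding event_def
proof (rule pmf_embed_pmf)
  let ?p = "\<lambda>e. case e of None \<Rightarrow> (\<Sum>s\<in>UNIV. w s - a s - d n s) / \<Lambda>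
    | Some (s, u) \<Rightarrow> (if u then a s else d n s) / \<Lambda>"
  have "0 \<le> w s - a s - d n s" for s using rate_le[of s n] by simp
  then show nonneg: "0 \<le> ?p e" for e
    using \<Lambda>_pos a_nonneg d_nonneg by (auto split: option.split intro!: divide_nonneg_pos sum_nonneg)
  have "(\<Sum>e\<in>UNIV. ?p e) = (\<Sum>s\<in>UNIV. w s - a s - d n s) / \<Lambda> + (\<Sum>s\<in>UNIV. a s / \<Lambda> + d n s / \<Lambda>)"
    by (subst sum_event[symmetric], intro sum.cong) (auto split: option.split)
  also have "\<dots> = (\<Sum>s\<in>UNIV. w s) / \<Lambda>"
    unfolding sum_divide_distrib sum.distrib[symmetric]
    by (intro sum.cong) (auto simp: diff_divide_distrib)
  also have "\<dots> = 1" using \<Lambda>_pos by (simp add: \<Lambda>_eq[symmetric])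
  finally show "(\<integral>\<^sup>+e. ennreal (?p e) \<partial>count_space UNIV) = 1"
    using nonneg by (simp add: nn_integral_count_space_finite)
qed

lemma expectation_ker: "(\<integral>m. f m \<partial>ker n) = step f n"
proof -
  let ?g = "\<lambda>e. case e of None \<Rightarrow> n | Some (s, u) \<Rightarrow> (if u then inc s n else dec s n)"
  have "(\<integral>m. f m \<partial>ker n) = (\<Sum>e\<in>UNIV. f (?g e) * pmf (event n) e)"
    unfolding ker_def by (simp add: integral_measure_pmf_real[where A = UNIV])
  also have "\<dots> = (\<Sum>e\<in>UNIV. (case e of None \<Rightarrow> f n * ((\<Sum>s\<in>UNIV. w s - a s - d n s) / \<Lambda>)
      | Some (s, u) \<Rightarrow> (if u then f (inc s n) * (a s / \<Lambda>) else f (dec s n) * (d n s / \<Lambda>))))"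
    by (intro sum.cong) (auto simp: pmf_event split: option.split)
  also have "\<dots> = f n * ((\<Sum>s\<in>UNIV. w s - a s - d n s) / \<Lambda>)
      + (\<Sum>s\<in>UNIV. f (inc s n) * (a s / \<Lambda>) + f (dec s n) * (d n s / \<Lambda>))"
    by (rule sum_event)
  also have "\<dots> = step f n"
    unfolding step_eq sum_divide_distrib sum_distrib_left sum.distrib[symmetric]
    by (intro sum.cong) (auto simp: add_divide_distrib mult.commute)
  finally show ?thesis .
qed

lemma pmf_ker: "pmf (ker n) m = step (indicator {m}) n"
  unfolding expectation_ker[symmetric] by (simp add: measure_pmf_single)

lemma set_ker:
  assumes "closed E" "n \<in> E"
  shows "set_pmf (ker n) \<subseteq> E"
proof
  fix m assume "m \<in> set_pmf (ker n)"
  then have "0 < step (indicator {m}) n" by (simp add: pmf_ker[symmetric] pmf_positive)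
  moreover have "step (indicator {m}) n \<le> step (\<lambda>_. 0) n" if "m \<notin> E"
    by (rule step_le[OF assms(1) _ assms(2)]) (use that in \<open>auto simp: indicator_def\<close>)
  ultimately show "m \<in> E" by (auto simp: step_const)
qed

lemma finite_set_ker: "finite (set_pmf (ker n))"
  by (simp add: ker_def)

lemma inc_in_set_ker: "a s \<noteq> 0 \<Longrightarrow> inc s n \<in> set_pmf (ker n)"
proof -
  assume "a s \<noteq> 0"
  then have "Some (s, True) \<in> set_pmf (event n)"
    using \<Lambda>_pos by (simp add: set_pmf_iff pmf_event)
  then show ?thesis unfolding ker_def set_map_pmf by (rule image_eqI[rotated]) simp
qed

lemma climb:
  assumes n: "P n" and inc: "\<And>n s. P n \<Longrightarrow> a s \<noteq> 0 \<Longrightarrow> P (inc s n)"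
    and m: "m \<in> fibre n" "n \<le> m"
  shows "P m"
  using m
proof (induction "\<Sum>s\<in>UNIV. m s" arbitrary: m rule: less_induct)
  case less
  show ?case
  proof (cases "m = n")
    case False
    then obtain s where "m s \<noteq> n s" by (auto simp: fun_eq_iff)
    with less.prems(2) have s: "n s < m s" by (metis le_funD le_neq_implies_less)
    then have a: "a s \<noteq> 0" using less.prems(1) by (auto simp: fibre_def)
    have "P (dec s m)"
    proof (rule less.hyps)
      show "(\<Sum>t\<in>UNIV. dec s m t) < (\<Sum>t\<in>UNIV. m t)"
        using s by (intro sum_strict_mono_ex1) auto
      show "dec s m \<in> fibre n" using less.prems(1) a by (auto simp: fibre_def)
      show "n \<le> dec s m" using less.prems(2) s by (auto simp: le_fun_def)
    qed
    from inc[OF this a] show ?thesis using s by simp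
  qed (use n in simp)
qed

lemma invariant_step:
  assumes "bind_pmf \<pi> ker = \<pi>" "\<And>n. \<bar>f n\<bar> \<le> C"
  shows "(\<integral>n. step f n \<partial>\<pi>) = (\<integral>n. f n \<partial>\<pi>)"
  using integral_bind_pmf_bounded[of f C \<pi> ker] assms by (simp add: expectation_ker)

lemma invariant_pow:
  assumes "bind_pmf \<pi> ker = \<pi>" "\<And>n. \<bar>f n\<bar> \<le> C"
  shows "(\<integral>n. (step ^^ j) f n \<partial>\<pi>) = (\<integral>n. f n \<partial>\<pi>)"
proof (induction j)
  case (Suc j)
  have "\<bar>(step ^^ j) f n\<bar> \<le> C" for n
    using pow_bounds[OF closed_UNIV, of "- C" f C n j] assms(2) by (auto simp: abs_le_iff minus_le_iff)
  from invariant_step[OF assms(1) this] show ?case using Suc by simp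
qed simp

lemma tendsto_step:
  assumes "\<And>m. (\<lambda>i. f i m) \<longlonglongrightarrow> g m"
  shows "(\<lambda>i. step (f i) n) \<longlonglongrightarrow> step g n"
  unfolding step_def using assms by (intro tendsto_intros) (use \<Lambda>_pos in auto)

end

section \<open>Stochastic monotonicity and its consequences for long-time behaviour\<close>

locale monotone_birth_death = birth_death \<Lambda> w a d
  for \<Lambda> :: real and w a :: "'r::finite \<Rightarrow> real" and d :: "('r \<Rightarrow> nat) \<Rightarrow> 'r \<Rightarrow> real" +
  assumes d_antimono: "\<And>n m s. n \<le> m \<Longrightarrow> n s = m s \<Longrightarrow> d m s \<le> d n s"
begin

text \<open>The inequality holds coordinate by coordinate. If \<open>n s = m s\<close>, the larger
  state departs at the smaller rate; if \<open>n s < m s\<close>, the state \<open>m\<close> remains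
  above \<open>n\<close> even after a departure.\<close>

lemma mono_step:
  assumes f: "mono f"
  shows "mono (step f)"
proof (rule monoI)
  fix n m :: "'r \<Rightarrow> nat" assume nm: "n \<le> m"
  show "step f n \<le> step f m"
    unfolding step_eq
  proof (intro divide_right_mono sum_mono)
    fix s
    have le: "n s \<le> m s" using nm by (simp add: le_fun_def)
    have up: "a s * f (inc s n) \<le> a s * f (inc s m)"
      using nm a_nonneg by (intro mult_left_mono monoD[OF f]) (auto simp: le_fun_def)
    have stay: "f n \<le> f m" using nm f by (auto dest: monoD)
    have dn: "f (dec s n) \<le> f n" "f (dec s m) \<le> f m"
      by (auto intro!: monoD[OF f] simp: le_fun_def)
    have "d n s * f (dec s n) + (w s - a s - d n s) * f n
        \<le> d m s * f (dec s m) + (w s - a s - d m s) * f m"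
    proof (cases "n s = m s")
      case True
      have dd: "f (dec s n) \<le> f (dec s m)"
        using nm True by (intro monoD[OF f]) (auto simp: le_fun_def)
      have "d n s * f (dec s n) + (w s - a s - d n s) * f n
          \<le> d m s * f (dec s n) + (w s - a s - d m s) * f n"
        using mult_left_mono[OF dn(1), of "d n s - d m s"] d_antimono[OF nm True]
        by (simp add: algebra_simps)
      also have "\<dots> \<le> d m s * f (dec s m) + (w s - a s - d m s) * f m"
        using d_nonneg[of m s] rate_le[of s m] dd stay
        by (intro add_mono mult_left_mono) auto
      finally show ?thesis .
    next
      case False
      then have "n s < m s" using le by simp
      then have n: "f n \<le> f (dec s m)"
        using nm by (intro monoD[OF f]) (auto simp: le_fun_def)
      have "d n s * f (dec s n) + (w s - a s - d n s) * f n
          \<le> d n s * f n + (w s - a s - d n s) * f n"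
        using mult_left_mono[OF dn(1) d_nonneg[of n s]] by simp
      also have "\<dots> = d m s * f n + (w s - a s - d m s) * f n"
        by (simp add: algebra_simps)
      also have "\<dots> \<le> d m s * f (dec s m) + (w s - a s - d m s) * f m"
        using d_nonneg[of m s] rate_le[of s m] n stay
        by (intro add_mono mult_left_mono) auto
      finally show ?thesis .
    qed
    with up show "a s * f (inc s n) + d n s * f (dec s n) + (w s - a s - d n s) * f n
        \<le> a s * f (inc s m) + d m s * f (dec s m) + (w s - a s - d m s) * f m"
      by linarith
  qed (use \<Lambda>_pos in auto)
qed

lemma mono_pow: "mono f \<Longrightarrow> mono ((step ^^ j) f)"
  by (induction j) (auto simp: mono_step)

lemma antimono_pow:
  assumes "antimono f" shows "antimono ((step ^^ j) f)"
proof -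
  have "mono ((step ^^ j) (\<lambda>n. (- 1) * f n))"
    using assms by (intro mono_pow) (auto simp: monotone_on_def)
  then show ?thesis unfolding pow_cmult by (auto simp: monotone_on_def)
qed


text \<open>No departure is possible at \<open>z\<close>, so one step cannot decrease the value of
  an increasing function there, and the powers of \<open>step\<close> keep functions
  increasing.\<close>

lemma pow_mono_at_origin:
  assumes f: "mono f" and z: "\<And>s. a s \<noteq> 0 \<Longrightarrow> z s = 0" and ij: "i \<le> j"
  shows "(step ^^ i) f z \<le> (step ^^ j) f z"
proof -
  have *: "g z \<le> step g z" if g: "mono g" for g
  proof -
    have "d z s = 0" for s using z d_zero d_frozen by (cases "a s = 0") auto
    moreover have "g z \<le> g (inc s z)" for s by (intro monoD[OF g]) (auto simp: le_fun_def)
    ultimately show ?thesis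
      using a_nonneg \<Lambda>_pos by (auto simp: step_def intro!: divide_nonneg_pos sum_nonneg)
  qed
  show ?thesis
    by (rule lift_Suc_mono_le[OF _ ij]) (use * mono_pow[OF f] in auto)
qed

lemma pow_antimono_at_origin:
  assumes f: "antimono f" and z: "\<And>s. a s \<noteq> 0 \<Longrightarrow> z s = 0" and ij: "i \<le> j"
  shows "(step ^^ j) f z \<le> (step ^^ i) f z"
proof -
  have "mono (\<lambda>n. (- 1) * f n)" using f by (auto simp: monotone_on_def)
  from pow_mono_at_origin[OF this z ij] show ?thesis unfolding pow_cmult by simp
qed

text \<open>Makes the invariance equation at \<open>y\<close> a finite sum, which is preserved by
  pointwise limits of laws.\<close>

lemma finite_predecessors: "finite {x. step (indicator {y}) x \<noteq> 0}"
proof (rule finite_subset)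
  show "{x. step (indicator {y}) x \<noteq> 0} \<subseteq> {y} \<union> range (\<lambda>s. dec s y) \<union> range (\<lambda>s. inc s y)"
  proof
    fix x assume "x \<in> {x. step (indicator {y}) x \<noteq> 0}"
    then have ne: "step (indicator {y}) x \<noteq> 0" by simp
    show "x \<in> {y} \<union> range (\<lambda>s. dec s y) \<union> range (\<lambda>s. inc s y)"
    proof (rule ccontr)
      assume no: "x \<notin> {y} \<union> range (\<lambda>s. dec s y) \<union> range (\<lambda>s. inc s y)"
      have "inc s x \<noteq> y" for s
      proof
        assume "inc s x = y"
        then have "x = dec s y" by auto
        then show False using no by auto
      qed
      moreover have "dec s x \<noteq> y" for s
      proof
        assume *: "dec s x = y"
        then have "x = y \<or> x = inc s y" unfolding *[symmetric] by (cases "x s = 0") auto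
        then show False using no by auto
      qed
      ultimately have "step (indicator {y}) x = 0"
        using no by (simp add: step_def)
      then show False using ne by simp
    qed
  qed
qed auto

text \<open>A point mass is the difference of the indicators of two up-sets, so that the law of the
  monotone chain started at the origin converges pointwise.\<close>

lemma invariant_or_null:
  assumes z: "\<And>s. a s \<noteq> 0 \<Longrightarrow> z s = 0"
  shows "(\<exists>\<pi>. set_pmf \<pi> \<subseteq> fibre z \<and> bind_pmf \<pi> ker = \<pi>) \<or>
    (\<forall>x. (\<lambda>j. (step ^^ j) (indicator {x}) z) \<longlonglongrightarrow> 0)"
proof -
  have zE: "z \<in> fibre z" by (simp add: fibre_def)
  have conv: "convergent (\<lambda>j. (step ^^ j) (indicator U) z)" if U: "mono (indicator U :: _ \<Rightarrow> real)" for U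
  proof (rule Bseq_monoseq_convergent)
    show "Bseq (\<lambda>j. (step ^^ j) (indicator U) z)"
      using pow_bounds[OF closed_UNIV, of 0 "indicator U" 1 z]
      by (intro BseqI'[of _ 1]) (auto simp: indicator_def)
    show "monoseq (\<lambda>j. (step ^^ j) (indicator U) z)"
      using pow_mono_at_origin[OF U z] by (auto simp: monoseq_def)
  qed
  have "convergent (\<lambda>j. (step ^^ j) (indicator {x}) z)" for x
  proof -
    let ?U = "{m. x \<le> m}" and ?V = "{m. x \<le> m \<and> m \<noteq> x}"
    have "(indicator {x} :: _ \<Rightarrow> real) = (\<lambda>m. indicator ?U m - indicator ?V m)"
      by (rule ext) (auto simp: indicator_def)
    then have "(\<lambda>j. (step ^^ j) (indicator {x}) z)
        = (\<lambda>j. (step ^^ j) (indicator ?U) z - (step ^^ j) (indicator ?V) z)"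
      by (simp only: pow_diff)
    moreover have "mono (indicator ?U :: _ \<Rightarrow> real)"
      by (rule monoI) (auto simp: indicator_def intro: order.trans)
    moreover have "mono (indicator ?V :: _ \<Rightarrow> real)"
      by (rule monoI) (auto simp: indicator_def intro: order.trans)
    ultimately show ?thesis by (simp add: conv convergent_diff)
  qed
  then obtain \<rho> where \<rho>: "\<And>x. (\<lambda>j. (step ^^ j) (indicator {x}) z) \<longlonglongrightarrow> \<rho> x"
    unfolding convergent_def by metis
  have \<rho>_nonneg: "0 \<le> \<rho> x" for x
    using pow_bounds(1)[OF closed_UNIV, of 0 "indicator {x}" 1 z]
    by (intro LIMSEQ_le_const[OF \<rho>]) (auto simp: indicator_def)
  have \<rho>_outside: "\<rho> x = 0" if "x \<notin> fibre z" for x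
  proof -
    have "(step ^^ j) (indicator {x}) z = 0" for j
    proof -
      have "0 \<le> (indicator {x} m :: real) \<and> indicator {x} m \<le> (0 :: real)" if "m \<in> fibre z" for m
        using that \<open>x \<notin> fibre z\<close> by (auto simp: indicator_def)
      from pow_bounds[where f = "indicator {x}" and j = j, OF closed_fibre this zE] show ?thesis by simp
    qed
    then show ?thesis using \<rho>[of x] by (simp add: LIMSEQ_const_iff)
  qed
  have \<rho>_sum: "sum \<rho> F \<le> 1" if "finite F" for F
  proof (rule LIMSEQ_le_const2)
    show "(\<lambda>j. \<Sum>x\<in>F. (step ^^ j) (indicator {x}) z) \<longlonglongrightarrow> sum \<rho> F"
      by (intro tendsto_sum \<rho>)
    have "(\<Sum>x\<in>F. (step ^^ j) (indicator {x}) z) \<le> 1" for j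
    proof -
      have "(\<Sum>x\<in>F. indicator {x} m) \<le> (1::real)" for m :: "'r \<Rightarrow> nat"
        using that card_mono[of "{m}" "F \<inter> {m}"] by (simp add: indicator_def)
      then show ?thesis
        using pow_le[OF closed_UNIV, of "\<lambda>m. \<Sum>x\<in>F. indicator {x} m" "\<lambda>_. 1" z j]
        by (simp add: pow_sum[OF that] pow_const)
    qed
    then show "\<exists>N. \<forall>j\<ge>N. (\<Sum>x\<in>F. (step ^^ j) (indicator {x}) z) \<le> 1" by blast
  qed
  have \<rho>_inv: "\<rho> y = (\<Sum>x | step (indicator {y}) x \<noteq> 0. step (indicator {y}) x * \<rho> x)" for y
  proof -
    let ?F = "{x. step (indicator {y}) x \<noteq> 0}"
    define K where "K = step (indicator {y})"
    have K: "K = (\<lambda>m. \<Sum>x\<in>?F. K x * indicator {x} m)"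
    proof
      fix m
      have "(\<Sum>x\<in>?F. K x * indicator {x} m) = (\<Sum>x\<in>?F. if x = m then K x else 0)"
        by (intro sum.cong) auto
      then show "K m = (\<Sum>x\<in>?F. K x * indicator {x} m)"
        using finite_predecessors[of y] by (simp add: K_def)
    qed
    have "(step ^^ Suc j) (indicator {y}) z = (\<Sum>x\<in>?F. K x * (step ^^ j) (indicator {x}) z)" for j
    proof -
      have "(step ^^ Suc j) (indicator {y}) z = (step ^^ j) K z"
        by (simp add: funpow_swap1 K_def)
      also have "\<dots> = (\<Sum>x\<in>?F. K x * (step ^^ j) (indicator {x}) z)"
        by (subst K) (simp add: pow_sum[OF finite_predecessors] pow_cmult)
      finally show ?thesis .
    qed
    then have "(\<lambda>j. \<Sum>x\<in>?F. K x * (step ^^ j) (indicator {x}) z) \<longlonglongrightarrow> \<rho> y"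
      using LIMSEQ_Suc[OF \<rho>[of y]] by simp
    moreover have "(\<lambda>j. \<Sum>x\<in>?F. K x * (step ^^ j) (indicator {x}) z)
        \<longlonglongrightarrow> (\<Sum>x\<in>?F. K x * \<rho> x)"
      by (intro tendsto_intros \<rho>)
    ultimately show ?thesis unfolding K_def by (rule LIMSEQ_unique)
  qed
  \<comment> \<open>A limit that is not identically 0 is an invariant measure of mass at most 1 and
    can be normalized.\<close>
  show ?thesis
  proof (cases "\<exists>x. \<rho> x \<noteq> 0")
    case True
    then obtain x where x: "0 < \<rho> x" using \<rho>_nonneg by (metis less_eq_real_def)
    then obtain \<pi> c where \<pi>: "0 < c" "\<And>x. pmf \<pi> x = \<rho> x / c"
      using exists_normalized_pmf[of \<rho> 1 x] \<rho>_nonneg \<rho>_sum by blast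
    have "set_pmf \<pi> \<subseteq> fibre z"
      using \<rho>_outside \<pi> by (auto simp: set_pmf_eq)
    moreover have "bind_pmf \<pi> ker = \<pi>"
    proof (rule pmf_eqI)
      fix y
      have "pmf (bind_pmf \<pi> ker) y = (\<integral>x. step (indicator {y}) x \<partial>\<pi>)"
        by (simp add: pmf_bind pmf_ker)
      also have "\<dots> = (\<Sum>x | step (indicator {y}) x \<noteq> 0. step (indicator {y}) x * pmf \<pi> x)"
        by (rule integral_measure_pmf_real) (auto simp: finite_predecessors)
      also have "\<dots> = pmf \<pi> y"
        unfolding \<pi> by (subst \<rho>_inv[of y]) (simp add: sum_divide_distrib)
      finally show "pmf (bind_pmf \<pi> ker) y = pmf \<pi> y" .
    qed
    ultimately show ?thesis by blast
  next
    case False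
    then show ?thesis using \<rho> by metis
  qed
qed

text \<open>The limit \<open>L\<close> of the decreasing sequence \<open>(step ^^ j) f z\<close> bounds \<open>(step ^^ j) f\<close> from above
  in the limit, so that the one-step equation at a state propagates convergence to \<open>L\<close> upwards.\<close>

lemma pow_tendsto_invariant:
  assumes f: "antimono f" "\<And>n. \<bar>f n\<bar> \<le> C" and z: "\<And>s. a s \<noteq> 0 \<Longrightarrow> z s = 0"
    and \<pi>: "set_pmf \<pi> \<subseteq> fibre z" "bind_pmf \<pi> ker = \<pi>"
  shows "(\<lambda>j. (step ^^ j) f z) \<longlonglongrightarrow> (\<integral>n. f n \<partial>\<pi>)"
proof -
  define V where "V j = (step ^^ j) f" for j
  have V_bound: "\<bar>V j n\<bar> \<le> C" for j n
    using pow_bounds[OF closed_UNIV, of "- C" f C n j] f(2)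
    by (auto simp: V_def abs_le_iff minus_le_iff)
  have V_anti: "antimono (V j)" for j unfolding V_def by (rule antimono_pow[OF f(1)])
  have "decseq (\<lambda>j. V j z)"
    unfolding decseq_def V_def using pow_antimono_at_origin[where z = z, OF f(1) z] by blast
  then obtain L where L: "(\<lambda>j. V j z) \<longlonglongrightarrow> L"
    using decseq_convergent[of "\<lambda>j. V j z" "- C"] V_bound by (metis abs_le_iff minus_le_iff)
  have up: "(\<lambda>j. V j (inc s y)) \<longlonglongrightarrow> L"
    if y: "(\<lambda>j. V j y) \<longlonglongrightarrow> L" and below: "\<And>t. d y t \<noteq> 0 \<Longrightarrow> (\<lambda>j. V j (dec t y)) \<longlonglongrightarrow> L"
      and s: "a s \<noteq> 0" for y s
  proof -
    define A where "A t j = a t * (V j (inc t y) - V j y)" for t j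
    define D where "D t j = d y t * (V j (dec t y) - V j y)" for t j
    \<comment> \<open>All arrival terms have the same sign, so each of them tends to 0 once their
      sum does.\<close>
    have A0: "A t j \<le> 0" for t j
      unfolding A_def using a_nonneg
      by (intro mult_nonneg_nonpos) (auto intro!: antimonoD[OF V_anti] simp: le_fun_def)
    have "D t \<longlonglongrightarrow> 0" for t
    proof (cases "d y t = 0")
      case False
      have "D t \<longlonglongrightarrow> d y t * (L - L)"
        unfolding D_def by (intro tendsto_intros y below False)
      then show ?thesis by simp
    qed (simp add: D_def[abs_def])
    then have "(\<lambda>j. \<Sum>t\<in>UNIV. D t j) \<longlonglongrightarrow> 0" using tendsto_sum[of UNIV D "\<lambda>_. 0"] by simp
    moreover have "(\<lambda>j. \<Lambda> * (V (Suc j) y - V j y)) \<longlonglongrightarrow> \<Lambda> * (L - L)"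
      by (intro tendsto_intros y LIMSEQ_Suc[OF y])
    moreover have "\<Lambda> * (V (Suc j) y - V j y) = (\<Sum>t\<in>UNIV. A t j) + (\<Sum>t\<in>UNIV. D t j)" for j
      using \<Lambda>_pos by (simp add: V_def step_def A_def D_def sum.distrib)
    ultimately have sumA: "(\<lambda>j. \<Sum>t\<in>UNIV. A t j) \<longlonglongrightarrow> 0"
      using tendsto_diff[of "\<lambda>j. (\<Sum>t\<in>UNIV. A t j) + (\<Sum>t\<in>UNIV. D t j)" 0 sequentially
          "\<lambda>j. \<Sum>t\<in>UNIV. D t j" 0] by simp
    have "(\<Sum>t\<in>UNIV. A t j) \<le> A s j" for j
      using sum_nonpos[of "UNIV - {s}" "\<lambda>t. A t j"] A0 by (simp add: sum.remove[of UNIV s])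
    then have "A s \<longlonglongrightarrow> 0"
      using A0 by (intro tendsto_sandwich[OF _ _ sumA tendsto_const]) auto
    then have "(\<lambda>j. A s j / a s + V j y) \<longlonglongrightarrow> 0 / a s + L"
      using s by (intro tendsto_intros y)
    then show ?thesis using s by (simp add: A_def)
  qed
  \<comment> \<open>Induction on the number of calls in the free coordinates: \<open>y\<close>
    arises by an arrival at \<open>dec s y\<close>, and departures from \<open>dec s y\<close> lead
    to still smaller states.\<close>
  have V_lim: "(\<lambda>j. V j y) \<longlonglongrightarrow> L" if "y \<in> fibre z" for y
    using that
  proof (induction "\<Sum>s | a s \<noteq> 0. y s" arbitrary: y rule: less_induct)
    case less
    have smaller: "(\<Sum>s | a s \<noteq> 0. dec t x s) < (\<Sum>s | a s \<noteq> 0. x s)"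
      if "a t \<noteq> 0" "x t \<noteq> 0" for t and x :: "'r \<Rightarrow> nat"
      using that by (intro sum_strict_mono_ex1) auto
    have fib: "dec t x \<in> fibre z" if "a t \<noteq> 0" "x \<in> fibre z" for t x
      using that by (auto simp: fibre_def)
    show ?case
    proof (cases "\<exists>s. a s \<noteq> 0 \<and> y s \<noteq> 0")
      case True
      then obtain s where s: "a s \<noteq> 0" "y s \<noteq> 0" by blast
      let ?x = "dec s y"
      have x: "(\<Sum>s | a s \<noteq> 0. ?x s) < (\<Sum>s | a s \<noteq> 0. y s)" "?x \<in> fibre z"
        using smaller[of s y] s fib[OF s(1) less.prems] by auto
      have "(\<lambda>j. V j (inc s ?x)) \<longlonglongrightarrow> L"
      proof (rule up[OF less.hyps[OF x] _ s(1)])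
        fix t assume "d ?x t \<noteq> 0"
        then have t: "a t \<noteq> 0" "?x t \<noteq> 0" using d_zero d_frozen by metis+
        have "(\<Sum>s | a s \<noteq> 0. dec t ?x s) < (\<Sum>s | a s \<noteq> 0. y s)"
          using smaller[of t ?x] t x(1) by linarith
        then show "(\<lambda>j. V j (dec t ?x)) \<longlonglongrightarrow> L"
          by (rule less.hyps[OF _ fib[OF t(1) x(2)]])
      qed
      moreover have "inc s ?x = y" using s by auto
      ultimately show ?thesis by simp
    next
      case False
      then have "y s = z s" for s using less.prems z[of s] by (cases "a s = 0") (auto simp: fibre_def)
      then have "y = z" by (rule ext)
      then show ?thesis using L by simp
    qed
  qed
  have "(\<lambda>j. \<integral>n. V j n \<partial>\<pi>) \<longlonglongrightarrow> (\<integral>n. L \<partial>\<pi>)"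
    by (rule integral_dominated_convergence[where w = "\<lambda>_. C"])
      (use V_lim V_bound \<pi>(1) in \<open>auto intro!: AE_pmfI\<close>)
  moreover have "(\<integral>n. V j n \<partial>\<pi>) = (\<integral>n. f n \<partial>\<pi>)" for j
    unfolding V_def by (rule invariant_pow[OF \<pi>(2) f(2)])
  ultimately have "(\<integral>n. f n \<partial>\<pi>) = L" by (simp add: LIMSEQ_const_iff)
  then show ?thesis using L by (simp add: V_def)
qed

text \<open>The steps of one process are exchanged for those of the other one at a time. On
  increasing functions that ignore \<open>r\<close>, larger departure rates give a smaller
  generator, and \<open>step\<close> preserves this class of functions.\<close>

lemma dominated_pow:
  assumes "birth_death \<Lambda> w a' d'"
    and a: "\<And>s. s \<noteq> r \<Longrightarrow> a' s = a s" and d: "\<And>n s. s \<noteq> r \<Longrightarrow> d n s \<le> d' n s"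
    and indep: "\<And>n k s. s \<noteq> r \<Longrightarrow> d (n(r := k)) s = d n s"
    and f: "mono f" "\<And>n k. f (n(r := k)) = f n"
  shows "(birth_death.step \<Lambda> a' d' ^^ j) f n \<le> (step ^^ j) f n"
  using f
proof (induction j arbitrary: f n)
  case (Suc j)
  interpret U: birth_death \<Lambda> w a' d' by fact
  have le: "U.step f m \<le> step f m" for m
    unfolding U.step_def step_def
  proof (intro add_left_mono divide_right_mono sum_mono)
    fix s
    show "a' s * (f (inc s m) - f m) + d' m s * (f (dec s m) - f m)
        \<le> a s * (f (inc s m) - f m) + d m s * (f (dec s m) - f m)"
    proof (cases "s = r")
      case True
      have "f (m(r := v)) = f m" for v by (rule Suc.prems(2))
      then show ?thesis using True by simp
    next
      case False
      have "f (dec s m) \<le> f m" by (intro monoD[OF Suc.prems(1)]) (auto simp: le_fun_def)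
      then have "d' m s * (f (dec s m) - f m) \<le> d m s * (f (dec s m) - f m)"
        using d[OF False, of m] by (intro mult_right_mono_neg) auto
      then show ?thesis using a[OF False] by simp
    qed
  qed (use \<Lambda>_pos in auto)
  have "(U.step ^^ Suc j) f n = (U.step ^^ j) (U.step f) n" by (simp add: funpow_swap1)
  also have "\<dots> \<le> (U.step ^^ j) (step f) n" by (rule U.pow_le[OF U.closed_UNIV]) (auto intro: le)
  also have "\<dots> \<le> (step ^^ j) (step f) n"
  proof (rule Suc.IH)
    show "mono (step f)" by (rule mono_step[OF Suc.prems(1)])
    show "step f (n(r := k)) = step f n" for n k
      by (rule step_indep[where f = f]) (rule indep Suc.prems(2), assumption?)+
  qed
  also have "\<dots> = (step ^^ Suc j) f n" by (simp add: funpow_swap1)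
  finally show ?case .
qed simp

text \<open>Starting at \<open>z\<close> instead of in \<open>\<pi>\<close> only lowers the mean of
  an increasing function, and \<open>\<pi>\<close> is invariant. Since \<open>f\<close> ignores the
  coordinate \<open>r\<close>, it may be reset to \<open>l\<close> before \<open>z\<close> is
  compared with the support of \<open>\<pi>\<close>.\<close>

lemma dominated_pow_le_integral:
  assumes "birth_death \<Lambda> w a' d'"
    and "\<And>s. s \<noteq> r \<Longrightarrow> a' s = a s" and "\<And>n s. s \<noteq> r \<Longrightarrow> d n s \<le> d' n s"
    and indep: "\<And>n k s. s \<noteq> r \<Longrightarrow> d (n(r := k)) s = d n s"
    and f: "mono f" "\<And>n k. f (n(r := k)) = f n" "\<And>n. \<bar>f n\<bar> \<le> C"
    and inv: "bind_pmf \<pi> ker = \<pi>" and z: "\<And>x. x \<in> set_pmf \<pi> \<Longrightarrow> z(r := l) \<le> x"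
  shows "(birth_death.step \<Lambda> a' d' ^^ j) f z \<le> (\<integral>n. f n \<partial>\<pi>)"
proof -
  have ind: "(step ^^ i) f (n(r := k)) = (step ^^ i) f n" for i n k
    by (induction i arbitrary: n k) (use f(2) step_indep[OF indep] in auto)
  have bound: "\<bar>(step ^^ j) f n\<bar> \<le> C" for n
    using pow_bounds[OF closed_UNIV, of "- C" f C n j] f(3) by (auto simp: abs_le_iff minus_le_iff)
  have "(birth_death.step \<Lambda> a' d' ^^ j) f z \<le> (step ^^ j) f z"
    by (rule dominated_pow) fact+
  also have "\<dots> = (\<integral>n. (step ^^ j) f z \<partial>\<pi>)" by simp
  also have "\<dots> \<le> (\<integral>n. (step ^^ j) f n \<partial>\<pi>)"
  proof (rule integral_mono_AE)
    show "AE x in \<pi>. (step ^^ j) f z \<le> (step ^^ j) f x"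
      using z by (intro AE_pmfI) (metis ind monoD mono_pow[OF f(1)])
  qed (use bound in \<open>auto intro!: measure_pmf.integrable_const_bound[where B = C]\<close>)
  also have "\<dots> = (\<integral>n. f n \<partial>\<pi>)" by (rule invariant_pow[OF inv f(3)])
  finally show ?thesis .
qed

end


subsection \<open>Uniformization of the network\<close>

locale monotonic_network =
  fixes \<nu> \<mu> :: "'r::finite \<Rightarrow> real" and b :: "('r \<Rightarrow> nat) \<Rightarrow> 'r \<Rightarrow> real" and B :: real
  assumes \<nu>_pos: "\<And>r. 0 < \<nu> r" and \<mu>_pos: "\<And>r. 0 < \<mu> r"
    and monotonic: "monotonic_control b" and b_le: "\<And>n r. b n r \<le> B"
begin

text \<open>This bound on the total rate of a coordinate does not involve the set \<open>A\<close>,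
  so all processes below share one clock rate.\<close>

definition w :: "'r \<Rightarrow> real" where "w s = \<nu> s + \<mu> s * B"

definition \<Lambda> :: real where "\<Lambda> = (\<Sum>s\<in>UNIV. w s)"

definition arr :: "'r set \<Rightarrow> 'r \<Rightarrow> real" where
  "arr A s = (if s \<in> A then \<nu> s else 0)"

definition dep :: "'r set \<Rightarrow> ('r \<Rightarrow> nat) \<Rightarrow> 'r \<Rightarrow> real" where
  "dep A n s = (if s \<in> A then \<mu> s * limit_control b A n s else 0)"

text \<open>The empty state in extensional form; the value \<open>undefined\<close> outside
  \<open>A\<close> makes its fibre equal to \<open>states A\<close>.\<close>

definition zero :: "'r set \<Rightarrow> 'r \<Rightarrow> nat" where
  "zero A = (\<lambda>s. if s \<in> A then 0 else undefined)"

lemma B_nonneg: "0 \<le> B"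
proof -
  have "0 \<le> b (\<lambda>_. 0) undefined"
    using monotonic by (simp add: monotonic_control_def bounded_control_def control_def)
  then show ?thesis using b_le order.trans by blast
qed

lemma \<Lambda>_pos: "0 < \<Lambda>"
  unfolding \<Lambda>_def w_def using \<nu>_pos \<mu>_pos B_nonneg
  by (intro sum_pos add_pos_nonneg mult_nonneg_nonneg) (auto intro: less_imp_le)

lemmas lc_nonneg = limit_control_nonneg[OF monotonic b_le]
  and lc_le = limit_control_le[OF monotonic b_le]
  and lc_zero = limit_control_zero[OF monotonic b_le]
  and lc_antimono = limit_control_antimono[OF monotonic b_le]
  and lc_mono_own = limit_control_mono_own[OF monotonic b_le]
  and lc_outside = tendsto_limit_control_outside[OF monotonic b_le]
  and lc_inside = tendsto_limit_control_inside[OF monotonic b_le]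
  and lc_outside_bounds = limit_control_outside_bounds[OF monotonic b_le]
  and lc_outside_antimono = limit_control_outside_antimono[OF monotonic b_le]
  and lc_outside_upd = limit_control_outside_upd[OF monotonic b_le]

text \<open>The substitution \<open>\<tau>\<close> of the state covers both the limit process (\<open>\<tau> = id\<close>) and the process
  with one coordinate frozen.\<close>

lemma monotone_birth_death_subst:
  assumes A: "A \<subseteq> A'" and \<tau>: "mono \<tau>" "\<And>n s. s \<in> A \<Longrightarrow> \<tau> n s = n s"
  shows "monotone_birth_death \<Lambda> w (arr A)
    (\<lambda>n s. if s \<in> A then \<mu> s * limit_control b A' (\<tau> n) s else 0)"
proof
  show "\<Lambda> = sum w UNIV" by (simp add: \<Lambda>_def)
  show "0 < \<Lambda>" by (rule \<Lambda>_pos)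
  show "0 \<le> arr A s" for s using \<nu>_pos[of s] by (simp add: arr_def)
  show "0 \<le> (if s \<in> A then \<mu> s * limit_control b A' (\<tau> n) s else 0)" for n s
    using \<mu>_pos[of s] A by (auto intro!: mult_nonneg_nonneg lc_nonneg)
  show "arr A s + (if s \<in> A then \<mu> s * limit_control b A' (\<tau> n) s else 0) \<le> w s" for n s
    using \<nu>_pos[of s] \<mu>_pos[of s] A B_nonneg lc_le[of s A' "\<tau> n"]
    by (auto simp: arr_def w_def mult_left_mono)
  show "n s = 0 \<Longrightarrow> (if s \<in> A then \<mu> s * limit_control b A' (\<tau> n) s else 0) = 0" for n s
    using lc_zero[of s A' "\<tau> n"] A \<tau>(2) by auto
  show "arr A s = 0 \<Longrightarrow> (if s \<in> A then \<mu> s * limit_control b A' (\<tau> n) s else 0) = 0" for n s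
    using \<nu>_pos[of s] by (auto simp: arr_def)
  show "n \<le> m \<Longrightarrow> n s = m s \<Longrightarrow> (if s \<in> A then \<mu> s * limit_control b A' (\<tau> m) s else 0)
      \<le> (if s \<in> A then \<mu> s * limit_control b A' (\<tau> n) s else 0)" for n m s
    using \<mu>_pos[of s] A \<tau>(2) lc_antimono[of s A' "\<tau> n" "\<tau> m"] monoD[OF \<tau>(1), of n m]
    by (auto simp: less_imp_le)
qed

sublocale A: monotone_birth_death \<Lambda> w "arr A" "dep A" for A
  using monotone_birth_death_subst[of A A "\<lambda>n. n"] by (simp add: dep_def[abs_def] mono_def)

lemma arr_eq_0_iff: "arr A s = 0 \<longleftrightarrow> s \<notin> A"
  using \<nu>_pos[of s] by (auto simp: arr_def)

lemma fibre_zero: "A.fibre A (zero A) = states A"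
  by (auto simp: A.fibre_def states_def arr_eq_0_iff zero_def PiE_def extensional_def)

lemma zero_zero: "arr A s \<noteq> 0 \<Longrightarrow> zero A s = 0"
  by (simp add: arr_eq_0_iff zero_def)

lemma rates_eq_pmf_ker:
  assumes "x \<noteq> y"
  shows "rates \<nu> \<mu> b A x y = \<Lambda> * pmf (A.ker A x) y"
proof -
  \<comment> \<open>Truncated subtraction makes \<open>dec s\<close> fix a state whose coordinate
    \<open>s\<close> is 0; the assumption that \<open>x\<close> and \<open>y\<close> differ excludes
    this case.\<close>
  have dec_iff: "dec s x = y \<longleftrightarrow> x = inc s y" for s
  proof
    assume *: "dec s x = y"
    then have "x s \<noteq> 0" using assms by (metis diff_0_eq_0 fun_upd_triv)
    then show "x = inc s y" using * by auto
  qed auto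
  have "rates \<nu> \<mu> b A x y = (\<Sum>s\<in>UNIV. arr A s * (indicator {y} (inc s x) - indicator {y} x)
      + dep A x s * (indicator {y} (dec s x) - indicator {y} x))"
    unfolding rates_def
  proof (intro sum.mono_neutral_cong_left ballI)
    fix s assume s: "s \<in> A"
    have "(if y = inc s x then \<nu> s else 0) = arr A s * (indicator {y} (inc s x) - indicator {y} x)"
      using assms s by (simp add: arr_def indicator_def eq_commute[of y])
    moreover have "(if x = inc s y then \<mu> s * limit_control b A x s else 0)
        = dep A x s * (indicator {y} (dec s x) - indicator {y} x)"
      unfolding dec_iff[symmetric] using assms s by (simp add: dep_def indicator_def)
    ultimately show "(if y = inc s x then \<nu> s else 0)
        + (if x = inc s y then \<mu> s * limit_control b A x s else 0)
        = arr A s * (indicator {y} (inc s x) - indicator {y} x)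
        + dep A x s * (indicator {y} (dec s x) - indicator {y} x)" by simp
  qed (auto simp: arr_def dep_def)
  then show ?thesis
    using assms \<Lambda>_pos by (simp add: A.pmf_ker A.step_def)
qed

sublocale A: uniformized "states A" "rates \<nu> \<mu> b A" \<Lambda> "A.ker A" for A
proof
  show "0 < \<Lambda>" by (rule \<Lambda>_pos)
  show set_ker: "set_pmf (A.ker A x) \<subseteq> states A" if "x \<in> states A" for x
    using A.set_ker[OF A.closed_fibre, of x A "zero A"] that by (simp add: fibre_zero)
  show "pmf (A.ker A x) y = (if x = y then 1 else 0) + generator (states A) (rates \<nu> \<mu> b A) x y / \<Lambda>"
    if xy: "x \<in> states A" "y \<in> states A" for x y
  proof (cases "x = y")
    case False
    then show ?thesis using \<Lambda>_pos by (simp add: generator_def rates_eq_pmf_ker)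
  next
    case True
    let ?F = "set_pmf (A.ker A x) - {x}"
    \<comment> \<open>The infinite sum in the generator reduces to the finite support of one step,
      where the total mass is 1.\<close>
    have "(\<Sum>\<^sub>\<infinity>z\<in>states A - {x}. rates \<nu> \<mu> b A x z) = (\<Sum>\<^sub>\<infinity>z\<in>?F. rates \<nu> \<mu> b A x z)"
      using set_ker[OF xy(1)]
      by (intro infsum_cong_neutral) (auto simp: rates_eq_pmf_ker set_pmf_iff)
    also have "\<dots> = (\<Sum>z\<in>?F. \<Lambda> * pmf (A.ker A x) z)"
      by (simp add: A.finite_set_ker) (intro sum.cong, auto simp: rates_eq_pmf_ker)
    also have "\<dots> = \<Lambda> * (1 - pmf (A.ker A x) x)"
    proof -
      have "pmf (A.ker A x) x + (\<Sum>z\<in>?F. pmf (A.ker A x) z) = (\<Sum>z\<in>insert x ?F. pmf (A.ker A x) z)"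
        by (rule sum.insert[symmetric]) (auto simp: A.finite_set_ker)
      also have "\<dots> = 1"
        by (rule sum_pmf_eq_1) (auto simp: A.finite_set_ker)
      finally have "(\<Sum>z\<in>?F. pmf (A.ker A x) z) = 1 - pmf (A.ker A x) x" by simp
      then show ?thesis by (simp add: sum_distrib_left[symmetric])
    qed
    finally show ?thesis using \<Lambda>_pos True by (simp add: generator_def)
  qed
qed

text \<open>From here on, stability is a question about invariant laws of a discrete kernel.\<close>

lemma stationary_distribution_iff:
  "stationary_distribution (states A) (rates \<nu> \<mu> b A) \<pi> \<longleftrightarrow>
    set_pmf \<pi> \<subseteq> states A \<and> bind_pmf \<pi> (A.ker A) = \<pi>"
  using A.stationary_distribution_imp_bind_eq A.bind_eq_imp_stationary_distribution
  by (auto simp: stationary_distribution_def)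

end


subsection \<open>Stability and instability of the enlarged process\<close>

lemma no_eventually_positive_partial_sums:
  fixes u :: "nat \<Rightarrow> real"
  assumes "0 < \<delta>" "\<And>j. J \<le> j \<Longrightarrow> \<delta> \<le> u j" and le: "\<And>N. (\<Sum>j<N. u j) \<le> C"
  shows False
proof -
  have lower: "(\<Sum>j<J. u j) + real m * \<delta> \<le> (\<Sum>j<J + m. u j)" for m
    using assms(2) by (induction m) (auto simp: algebra_simps intro: add_mono)
  obtain m :: nat where "(C - (\<Sum>j<J. u j)) / \<delta> < real m" using reals_Archimedean2 by blast
  then have "C < (\<Sum>j<J. u j) + real m * \<delta>" using assms(1) by (simp add: field_simps)
  with lower[of m] le[of "J + m"] show False by simp
qed

context monotonic_network
begin

lemma dep_inside_le:
  assumes "r \<notin> S" "s \<noteq> r"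
  shows "dep S n s \<le> dep (insert r S) n s"
  using assms lc_inside(2)[of r S s n "n r"] \<mu>_pos[of s] by (auto simp: dep_def)

lemma dep_upd: "r \<notin> S \<Longrightarrow> dep S (n(r := k)) s = dep S n s"
  by (simp add: dep_def lc_outside_upd)

lemma arr_insert: "s \<noteq> r \<Longrightarrow> arr (insert r S) s = arr S s"
  by (simp add: arr_def)

section \<open>Mean service above the load: stability\<close>

lemma expectation_pos_imp_stable:
  assumes r: "r \<notin> S" and \<pi>: "set_pmf \<pi> \<subseteq> states S" "bind_pmf \<pi> (A.ker S) = \<pi>"
    and drift: "\<nu> r / \<mu> r < (\<integral>n. limit_control b S n r \<partial>\<pi>)"
  shows "\<exists>\<rho>. set_pmf \<rho> \<subseteq> states (insert r S) \<and> bind_pmf \<rho> (A.ker (insert r S)) = \<rho>"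
proof (rule ccontr)
  assume unstable: "\<not> ?thesis"
  let ?T = "insert r S"
  define z where "z = zero ?T"
  \<comment> \<open>\<open>P j f\<close> is the mean of \<open>f\<close> after \<open>j\<close>
    steps from the empty state.\<close>
  define P where "P = (\<lambda>j f. (A.step ?T ^^ j) f z)"
  have null: "(\<lambda>j. P j (indicator {x})) \<longlonglongrightarrow> 0" for x
    using A.invariant_or_null[of ?T z] unstable zero_zero[of ?T]
    unfolding z_def P_def fibre_zero by blast
  have zE: "z \<in> A.fibre ?T z" by (simp add: A.fibre_def)
  have z_le: "z(r := 0) \<le> x" if "x \<in> set_pmf \<pi>" for x
    using that \<pi>(1) by (force simp: z_def zero_def le_fun_def states_def PiE_def extensional_def)
  \<comment> \<open>With \<open>r\<close> finite instead of infinite, the coordinates in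
    \<open>S\<close> depart faster; hence the comparison with \<open>\<pi>\<close>.\<close>
  have dom: "P j f \<le> (\<integral>n. f n \<partial>\<pi>)"
    if "mono f" "\<And>n k. f (n(r := k)) = f n" "\<And>n. \<bar>f n\<bar> \<le> C" for j f C
    unfolding P_def
    by (rule A.dominated_pow_le_integral[where r = r and l = 0 and C = C])
      (use that r \<pi> z_le in \<open>auto intro: dep_inside_le A.birth_death_axioms simp: dep_upd arr_insert\<close>)
  \<comment> \<open>The control of \<open>r\<close> at level \<open>k\<close>, as a function of the
    other coordinates. It increases in \<open>k\<close> to the limit control, so at some level its
    mean still exceeds \<open>\<nu> r / \<mu> r\<close>.\<close>
  define c where "c k n = limit_control b ?T (n(r := k)) r" for k n
  have c_bounds: "0 \<le> c k n" "c k n \<le> B" for k n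
    by (auto simp: c_def lc_nonneg lc_le)
  have c_lim: "(\<lambda>k. \<integral>n. c k n \<partial>\<pi>) \<longlonglongrightarrow> (\<integral>n. limit_control b S n r \<partial>\<pi>)"
    by (rule integral_dominated_convergence[where w = "\<lambda>_. B"])
      (use c_bounds lc_outside(1)[OF r] in \<open>auto simp: c_def\<close>)
  obtain k where k: "\<nu> r / \<mu> r < (\<integral>n. c k n \<partial>\<pi>)"
    using order_tendstoD(1)[OF c_lim drift] by (auto simp: eventually_sequentially)
  define g where "g M = (indicator {n. \<exists>s\<in>S. M < n s} :: _ \<Rightarrow> real)" for M :: nat
  have g_lim: "(\<lambda>M. \<integral>n. g M n \<partial>\<pi>) \<longlonglongrightarrow> (\<integral>n. 0 \<partial>\<pi>)"
  proof (rule integral_dominated_convergence[where w = "\<lambda>_. 1"])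
    show "AE n in \<pi>. (\<lambda>M. g M n) \<longlonglongrightarrow> 0"
    proof (intro AE_I2 tendsto_eventually)
      fix n :: "'r \<Rightarrow> nat"
      show "eventually (\<lambda>M. g M n = 0) sequentially"
        using eventually_ge_at_top[of "Max (range n)"]
      proof eventually_elim
        case (elim M)
        have "n s \<le> M" for s using elim Max_ge[of "range n" "n s"] by auto
        then show ?case by (auto simp: g_def indicator_def not_less)
      qed
    qed
  qed (auto simp: g_def)
  define h where "h = (indicator {n. n r < k} :: _ \<Rightarrow> real)"
  \<comment> \<open>If \<open>r\<close> is below \<open>k\<close>, either some coordinate in
    \<open>S\<close> exceeds \<open>M\<close>, which is unlikely by comparison with
    \<open>\<pi>\<close>, or the state lies in the finite set \<open>F\<close>, whose probability
    tends to 0.\<close>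
  have h_lim: "(\<lambda>j. P j h) \<longlonglongrightarrow> 0"
  proof (rule tendstoI)
    fix e :: real assume e: "0 < e"
    obtain M where M: "(\<integral>n. g M n \<partial>\<pi>) < e / 2"
      using order_tendstoD(2)[OF g_lim, of "e / 2"] e by (auto simp: eventually_sequentially)
    define F where "F = {x \<in> states ?T. (\<forall>s\<in>S. x s \<le> M) \<and> x r < k}"
    have fin: "finite F"
    proof (rule finite_subset)
      show "F \<subseteq> ?T \<rightarrow>\<^sub>E {..M + k}" by (auto simp: F_def states_def PiE_def extensional_def)
    qed (simp add: finite_PiE)
    have "h n \<le> g M n + (\<Sum>x\<in>F. indicator {x} n)" if "n \<in> A.fibre ?T z" for n
    proof (cases "n r < k \<and> \<not> (\<exists>s\<in>S. M < n s)")
      case True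
      then have "n \<in> F" using that by (auto simp: F_def z_def fibre_zero not_less)
      then show ?thesis using fin by (simp add: h_def g_def indicator_def)
    next
      case False
      then show ?thesis by (auto simp: h_def g_def indicator_def sum_nonneg)
    qed
    then have "P j h \<le> P j (\<lambda>n. g M n + (\<Sum>x\<in>F. indicator {x} n))" for j
      unfolding P_def by (rule A.pow_le[OF A.closed_fibre _ zE])
    also have "P j (\<lambda>n. g M n + (\<Sum>x\<in>F. indicator {x} n)) = P j (g M) + (\<Sum>x\<in>F. P j (indicator {x}))" for j
      unfolding P_def by (simp add: A.pow_add A.pow_sum[OF fin])
    finally have *: "P j h \<le> P j (g M) + (\<Sum>x\<in>F. P j (indicator {x}))" for j .
    have g_le: "P j (g M) \<le> (\<integral>n. g M n \<partial>\<pi>)" for j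
    proof (rule dom)
      show "mono (g M)"
        by (rule monoI) (auto simp: g_def indicator_def le_fun_def intro: less_le_trans)
      show "g M (n(r := l)) = g M n" for n l using r by (auto simp: g_def indicator_def)
      show "\<bar>g M n\<bar> \<le> 1" for n by (simp add: g_def)
    qed
    have "(\<lambda>j. \<Sum>x\<in>F. P j (indicator {x})) \<longlonglongrightarrow> (\<Sum>x\<in>F. 0)"
      by (intro tendsto_sum null)
    then have "eventually (\<lambda>j. (\<Sum>x\<in>F. P j (indicator {x})) < e / 2) sequentially"
      using e by (intro order_tendstoD(2)[where y = "0::real"]) auto
    then show "eventually (\<lambda>j. dist (P j h) 0 < e) sequentially"
    proof eventually_elim
      case (elim j)
      have "0 \<le> P j h"
        unfolding P_def by (rule A.pow_bounds(1)[OF A.closed_UNIV, of 0 h 1]) (auto simp: h_def)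
      then show ?case using elim *[of j] g_le[of j] M by simp
    qed
  qed
  \<comment> \<open>This function is unbounded, but \<open>step\<close> is a finite sum, so
    \<open>P j f\<close> is finite and the linear rules apply.\<close>
  define f where "f n = real (n r)" for n :: "'r \<Rightarrow> nat"
  have f_step: "A.step ?T f n = f n + (\<nu> r - \<mu> r * limit_control b ?T n r) / \<Lambda>" for n
  proof -
    have "(\<Sum>s\<in>UNIV. arr ?T s * (f (inc s n) - f n) + dep ?T n s * (f (dec s n) - f n))
        = (\<Sum>s\<in>UNIV. if s = r then \<nu> r - \<mu> r * limit_control b ?T n r else 0)"
    proof (rule sum.cong)
      fix s
      show "arr ?T s * (f (inc s n) - f n) + dep ?T n s * (f (dec s n) - f n)
          = (if s = r then \<nu> r - \<mu> r * limit_control b ?T n r else 0)"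
        using lc_zero[of r ?T n] by (cases "n r") (auto simp: f_def arr_def dep_def)
    qed simp
    then show ?thesis by (simp add: A.step_def)
  qed
  have inc_le: "P (Suc j) f - P j f \<le> (\<nu> r - \<mu> r * ((\<integral>n. c k n \<partial>\<pi>) - B * P j h)) / \<Lambda>" for j
  proof -
    \<comment> \<open>From level \<open>k\<close> on, the control of \<open>r\<close> is at least
      \<open>c k\<close>; below it, the possible loss of at most \<open>B\<close> is charged to
      \<open>h\<close>.\<close>
    have "c k n - B * h n \<le> limit_control b ?T n r" for n
    proof (cases "n r < k")
      case True
      then show ?thesis using c_bounds(2)[of k n] lc_nonneg[of r ?T n] by (simp add: h_def)
    next
      case False
      then show ?thesis using lc_mono_own[of r ?T k "n r" n] by (simp add: h_def c_def)
    qed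
    then have "A.step ?T f n \<le> f n + (\<nu> r - \<mu> r * (c k n - B * h n)) / \<Lambda>" for n
      unfolding f_step using \<mu>_pos[of r] \<Lambda>_pos by (intro add_left_mono divide_right_mono) auto
    then have "P j (A.step ?T f) \<le> P j (\<lambda>n. f n + (\<nu> r - \<mu> r * (c k n - B * h n)) / \<Lambda>)"
      unfolding P_def by (intro A.pow_le[OF A.closed_UNIV]) auto
    also have "(\<lambda>n. f n + (\<nu> r - \<mu> r * (c k n - B * h n)) / \<Lambda>)
        = (\<lambda>n. f n + (1 / \<Lambda>) * (\<nu> r - \<mu> r * (c k n - B * h n)))" by simp
    also have "P j \<dots> = P j f + (1 / \<Lambda>) * (\<nu> r - \<mu> r * (P j (c k) - B * P j h))"
      unfolding P_def by (simp only: A.pow_add A.pow_cmult A.pow_diff A.pow_const)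
    also have "P j (A.step ?T f) = P (Suc j) f"
      unfolding P_def by (simp add: funpow_swap1)
    finally have "P (Suc j) f - P j f \<le> (\<nu> r - \<mu> r * (P j (c k) - B * P j h)) / \<Lambda>" by simp
    moreover have "(\<integral>n. c k n \<partial>\<pi>) \<le> P j (c k)"
    proof -
      \<comment> \<open>Domination concerns increasing functions, whereas \<open>c k\<close> is
        decreasing; hence the sign.\<close>
      have "P j (\<lambda>n. (- 1) * c k n) \<le> (\<integral>n. (- 1) * c k n \<partial>\<pi>)"
      proof (rule dom)
        show "mono (\<lambda>n. (- 1) * c k n)"
          unfolding c_def by (rule monoI) (auto intro!: lc_antimono simp: le_fun_def)
        show "\<bar>(- 1) * c k n\<bar> \<le> B" for n using c_bounds[of k n] by simp
      qed (simp add: c_def)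
      then show ?thesis unfolding P_def A.pow_cmult by simp
    qed
    ultimately show ?thesis
      using \<mu>_pos[of r] \<Lambda>_pos
      by (elim order.trans) (auto intro!: divide_right_mono mult_left_mono)
  qed
  define \<epsilon> where "\<epsilon> = \<mu> r * (\<integral>n. c k n \<partial>\<pi>) - \<nu> r"
  have \<epsilon>: "0 < \<epsilon>" using k \<mu>_pos[of r] by (simp add: \<epsilon>_def field_simps)
  have "(\<lambda>j. \<mu> r * (B * P j h)) \<longlonglongrightarrow> \<mu> r * (B * 0)"
    by (intro tendsto_intros h_lim)
  then have "eventually (\<lambda>j. \<mu> r * (B * P j h) < \<epsilon> / 2) sequentially"
    using \<epsilon> by (intro order_tendstoD(2)) auto
  then obtain J where J: "\<And>j. J \<le> j \<Longrightarrow> \<mu> r * (B * P j h) < \<epsilon> / 2"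
    by (auto simp: eventually_sequentially)
  show False
  proof (rule no_eventually_positive_partial_sums)
    show "0 < \<epsilon> / 2 / \<Lambda>" using \<epsilon> \<Lambda>_pos by simp
    show "\<epsilon> / 2 / \<Lambda> \<le> P j f - P (Suc j) f" if "J \<le> j" for j
    proof -
      have "\<epsilon> / 2 \<le> - (\<nu> r - \<mu> r * ((\<integral>n. c k n \<partial>\<pi>) - B * P j h))"
      proof -
        have "- (\<nu> r - \<mu> r * ((\<integral>n. c k n \<partial>\<pi>) - B * P j h)) = \<epsilon> - \<mu> r * (B * P j h)"
          by (simp add: \<epsilon>_def algebra_simps)
        then show ?thesis using J[OF that] by linarith
      qed
      then have "\<epsilon> / 2 / \<Lambda> \<le> - ((\<nu> r - \<mu> r * ((\<integral>n. c k n \<partial>\<pi>) - B * P j h)) / \<Lambda>)"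
        unfolding minus_divide_left using \<Lambda>_pos by (intro divide_right_mono) auto
      then show ?thesis using inc_le[of j] by linarith
    qed
    have P_f: "0 \<le> P N f" for N
      using A.pow_le[OF A.closed_UNIV, where f = "\<lambda>_. 0" and g = f and n = z and j = N and A = ?T] by (simp add: P_def A.pow_const f_def)
    show "(\<Sum>j<N. P j f - P (Suc j) f) \<le> P 0 f" for N
      using P_f[of N] sum_lessThan_telescope'[of "\<lambda>j. P j f" N] by simp
  qed
qed

section \<open>Mean service below the load: instability\<close>

lemma expectation_neg_imp_unstable:
  assumes r: "r \<notin> S" and \<pi>: "set_pmf \<pi> \<subseteq> states S" "bind_pmf \<pi> (A.ker S) = \<pi>"
    and drift: "(\<integral>n. limit_control b S n r \<partial>\<pi>) < \<nu> r / \<mu> r"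
    and \<rho>: "set_pmf \<rho> \<subseteq> states (insert r S)" "bind_pmf \<rho> (A.ker (insert r S)) = \<rho>"
  shows False
proof -
  let ?T = "insert r S"
  define z where "z = zero S"
  define c where "c n = limit_control b S n r" for n
  \<comment> \<open>Departure rates of the coordinates in \<open>S\<close> while \<open>r\<close> is
    held at level \<open>k\<close>.\<close>
  define d where "d k n s = (if s \<in> S then \<mu> s * limit_control b ?T (n(r := k)) s else 0)" for k n s
  have c_bounds: "0 \<le> c n" "c n \<le> B" for n
    using lc_outside_bounds[OF r] by (auto simp: c_def)
  have c_anti: "antimono c"
    unfolding c_def by (rule antimonoI) (rule lc_outside_antimono[OF r])
  interpret F: monotone_birth_death \<Lambda> w "arr S" "d k" for k
    unfolding d_def using r by (intro monotone_birth_death_subst) (auto simp: mono_def le_fun_def)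
  have z0: "arr S s \<noteq> 0 \<Longrightarrow> z s = 0" for s
    unfolding z_def by (rule zero_zero)
  have z_le: "z(r := 0) \<le> x" if "x \<in> set_pmf \<pi>" for x
    using that \<pi>(1) by (force simp: z_def zero_def le_fun_def states_def PiE_def extensional_def)
  have dep_le_d: "dep S n s \<le> d k n s" for k n s
    using lc_inside(2)[of r S s n k] \<mu>_pos[of s] r by (auto simp: dep_def d_def)
  have dom: "(F.step k ^^ j) f z \<le> (\<integral>n. f n \<partial>\<pi>)"
    if "mono f" "\<And>n k. f (n(r := k)) = f n" "\<And>n. \<bar>f n\<bar> \<le> C" for j f C k
    by (rule A.dominated_pow_le_integral[where r = r and l = 0 and C = C])
      (use that r \<pi> z_le dep_le_d in \<open>auto intro: F.birth_death_axioms simp: dep_upd\<close>)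

  \<comment> \<open>Choice of the level \<open>k\<close>\<close>
  have "(\<lambda>j. (A.step S ^^ j) c z) \<longlonglongrightarrow> (\<integral>n. c n \<partial>\<pi>)"
    using c_bounds \<pi> z0
    by (intro A.pow_tendsto_invariant[where C = B] c_anti) (auto simp: z_def fibre_zero)
  \<comment> \<open>The drift is secured at a finite horizon \<open>J\<close>, because the passage
    to the limit in \<open>k\<close> below is for a fixed number of steps.\<close>
  from order_tendstoD(2)[OF this drift[folded c_def]] obtain J
    where J: "(A.step S ^^ J) c z < \<nu> r / \<mu> r"
    by (auto simp: eventually_sequentially)
  \<comment> \<open>Over a fixed number of steps only finitely many rates enter, and each converges
    as \<open>k\<close> grows.\<close>
  have "(\<lambda>k. (F.step k ^^ j) c n) \<longlonglongrightarrow> (A.step S ^^ j) c n" for j n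
  proof (induction j arbitrary: n)
    case (Suc j)
    have "(\<lambda>k. d k n s) \<longlonglongrightarrow> dep S n s" for s
      using lc_inside(1)[of r S s n] r by (cases "s \<in> S") (auto simp: d_def dep_def intro: tendsto_mult_left)
    moreover define V where "V k = (F.step k ^^ j) c" for k
    moreover define W where "W = (A.step S ^^ j) c"
    ultimately have "(\<lambda>k. F.step k (V k) n) \<longlonglongrightarrow> A.step S W n"
      using \<Lambda>_pos Suc unfolding F.step_def A.step_def by (intro tendsto_intros) auto
    then show ?case by (simp add: V_def W_def)
  qed simp
  from order_tendstoD(2)[OF this J] obtain K
    where K: "\<And>k. K \<le> k \<Longrightarrow> (F.step k ^^ J) c z < \<nu> r / \<mu> r"
    by (auto simp: eventually_sequentially)
  obtain v where v: "v \<in> set_pmf \<rho>" using set_pmf_not_empty[of \<rho>] by auto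
  \<comment> \<open>Exceeding \<open>v r\<close> makes the escape probability vanish at the state
    \<open>v\<close> of the support of \<open>\<rho>\<close>.\<close>
  define k where "k = Suc (max K (v r))"
  have k: "(F.step k ^^ J) c z < \<nu> r / \<mu> r" "v r < k" "0 < k"
    using K[of k] by (auto simp: k_def)

  text \<open>\<open>h N n\<close> is the probability that the coordinate \<open>r\<close> of the process started in \<open>n\<close> stays
    at or above \<open>k\<close> for \<open>N\<close> steps; its limit \<open>l\<close> is a bounded subharmonic function.\<close>

  define h where
    "h N = ((\<lambda>f n. if k \<le> n r then A.step ?T f n else 0) ^^ N) (indicator {n. k \<le> n r})" for N
  have h_0: "h 0 n = (if k \<le> n r then 1 else 0)" for n by (simp add: h_def indicator_def)
  have h_Suc: "h (Suc N) n = (if k \<le> n r then A.step ?T (h N) n else 0)" for N n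
    by (simp add: h_def)
  have step_bounds: "0 \<le> A.step ?T f n \<and> A.step ?T f n \<le> 1" if "\<And>m. 0 \<le> f m \<and> f m \<le> 1" for f n
    using A.pow_bounds[OF A.closed_UNIV, where l = 0 and f = f and u = 1 and n = n and j = 1 and A = ?T] that by simp
  have h_bounds: "0 \<le> h N n \<and> h N n \<le> 1" for N n
    by (induction N arbitrary: n) (use step_bounds in \<open>auto simp: h_0 h_Suc\<close>)
  have h_mono: "mono (h N)" for N
  proof (induction N)
    case 0
    show ?case by (rule monoI) (auto simp: h_0 le_fun_def intro: order.trans)
  next
    case (Suc N)
    show ?case
    proof (rule monoI)
      fix n m :: "'r \<Rightarrow> nat" assume nm: "n \<le> m"
      then have "n r \<le> m r" by (simp add: le_fun_def)
      then show "h (Suc N) n \<le> h (Suc N) m"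
        using monoD[OF A.mono_step[OF Suc, where A = ?T] nm] step_bounds[of "h N" m] h_bounds
        by (auto simp: h_Suc)
    qed
  qed
  have h_dec: "h (Suc N) n \<le> h N n" for N n
  proof (induction N arbitrary: n)
    case 0
    show ?case using step_bounds[of "h 0" n] h_bounds by (auto simp: h_Suc h_0)
  next
    case (Suc N)
    show ?case
      using A.step_le[OF A.closed_UNIV, where f = "h (Suc N)" and g = "h N" and n = n and A = ?T] Suc
      by (simp add: h_Suc[of "Suc N"] h_Suc[of N])
  qed
  \<comment> \<open>A step lowers the coordinate \<open>r\<close> by at most 1.\<close>
  have h_one: "h N n = 1" if "k + N \<le> n r" for N n
    using that
  proof (induction N arbitrary: n)
    case (Suc N)
    have "h N (inc s n) = 1" "h N (dec s n) = 1" "h N n = 1" for s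
      using Suc.prems by (auto intro!: Suc.IH)
    then show ?case using Suc.prems by (simp add: h_Suc A.step_def)
  qed (simp add: h_0)

  text \<open>The sum \<open>a M N x\<close> plays the role of \<open>M\<close> plus the mean of the minimum over \<open>N\<close> steps of the
    coordinate \<open>r\<close>, relative to its starting point; comparing consecutive \<open>N\<close> as in the maximal
    ergodic lemma bounds the escape probability from below by the drift.\<close>

  define a where "a M N x = (\<Sum>m=k..<k + M. h N (x(r := m)))" for M N x
  \<comment> \<open>A lower bound for the growth of \<open>a\<close> in one step: arrivals at
    \<open>r\<close> contribute \<open>\<nu> r\<close> times a sum over levels that telescopes to
    \<open>1 - h\<close>, departures from \<open>r\<close> at least
    \<open>- \<mu> r * c x\<close>.\<close>
  define G where "G i x = (\<nu> r - \<nu> r * h i (x(r := k)) - \<mu> r * c x) / \<Lambda>" for i x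
  \<comment> \<open>At levels from \<open>k\<close> on, the coordinates in \<open>S\<close> depart
    no faster than with \<open>r\<close> frozen at \<open>k\<close>, and \<open>r\<close> departs at
    rate at most \<open>\<mu> r * c x\<close>. As \<open>h N\<close> is increasing, inserting these
    bounds can only lower the value.\<close>
  have h_step: "F.step k (\<lambda>x. h N (x(r := m))) x
      + (\<nu> r * (h N (x(r := Suc m)) - h N (x(r := m))) + \<mu> r * c x * (h N (x(r := m - 1)) - h N (x(r := m)))) / \<Lambda>
      \<le> h (Suc N) (x(r := m))" if m: "k \<le> m" for N m x
  proof -
    let ?y = "x(r := m)"
    let ?t = "\<lambda>s. arr ?T s * (h N (inc s ?y) - h N ?y) + dep ?T ?y s * (h N (dec s ?y) - h N ?y)"
    let ?u = "\<lambda>s. arr S s * (h N ((inc s x)(r := m)) - h N ?y) + d k x s * (h N ((dec s x)(r := m)) - h N ?y)"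
    have dec_le: "h N (dec s n) \<le> h N n" for s n
      by (intro monoD[OF h_mono]) (auto simp: le_fun_def)
    have r_term: "\<nu> r * (h N (x(r := Suc m)) - h N ?y) + \<mu> r * c x * (h N (x(r := m - 1)) - h N ?y) \<le> ?t r"
    proof -
      have "limit_control b ?T ?y r \<le> c x" unfolding c_def by (rule lc_outside(2)[OF r])
      then have "\<mu> r * c x * (h N (dec r ?y) - h N ?y) \<le> dep ?T ?y r * (h N (dec r ?y) - h N ?y)"
        using \<mu>_pos[of r] dec_le[where s = r and n = ?y]
        by (intro mult_right_mono_neg) (auto simp: dep_def)
      then show ?thesis by (simp add: arr_def)
    qed
    have s_term: "?u s \<le> ?t s" if "s \<noteq> r" for s
    proof -
      have upd: "(inc s x)(r := m) = inc s ?y" "(dec s x)(r := m) = dec s ?y"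
        using that by (auto simp: fun_eq_iff)
      have "dep ?T ?y s \<le> d k x s"
        using that m \<mu>_pos[of s] lc_antimono[of s ?T "x(r := k)" ?y]
        by (auto simp: dep_def d_def le_fun_def)
      then have "d k x s * (h N (dec s ?y) - h N ?y) \<le> dep ?T ?y s * (h N (dec s ?y) - h N ?y)"
        using dec_le[where s = s and n = ?y] by (intro mult_right_mono_neg) auto
      then show ?thesis unfolding upd using arr_insert[OF that, where S = S] by simp
    qed
    have u_r: "?u r = 0" using r by (simp add: arr_def d_def)
    have "(\<Sum>s\<in>UNIV. ?u s) = (\<Sum>s\<in>UNIV - {r}. ?u s)"
      using u_r by (intro sum.mono_neutral_right) auto
    also have "\<dots> \<le> (\<Sum>s\<in>UNIV - {r}. ?t s)" by (intro sum_mono s_term) auto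
    finally have "(\<Sum>s\<in>UNIV. ?u s) + (\<nu> r * (h N (x(r := Suc m)) - h N ?y)
        + \<mu> r * c x * (h N (x(r := m - 1)) - h N ?y)) \<le> (\<Sum>s\<in>UNIV - {r}. ?t s) + ?t r"
      using r_term by simp
    also have "\<dots> = (\<Sum>s\<in>UNIV. ?t s)" by (rule trans[OF add.commute sum.remove[symmetric]]) auto
    finally have "((\<Sum>s\<in>UNIV. ?u s) + (\<nu> r * (h N (x(r := Suc m)) - h N ?y)
        + \<mu> r * c x * (h N (x(r := m - 1)) - h N ?y))) / \<Lambda> \<le> (\<Sum>s\<in>UNIV. ?t s) / \<Lambda>"
      using \<Lambda>_pos by (intro divide_right_mono) auto
    then have "h N ?y + (\<Sum>s\<in>UNIV. ?u s) / \<Lambda> + (\<nu> r * (h N (x(r := Suc m)) - h N ?y)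
        + \<mu> r * c x * (h N (x(r := m - 1)) - h N ?y)) / \<Lambda> \<le> h N ?y + (\<Sum>s\<in>UNIV. ?t s) / \<Lambda>"
      by (simp add: add_divide_distrib)
    moreover have "h (Suc N) ?y = h N ?y + (\<Sum>s\<in>UNIV. ?t s) / \<Lambda>"
      using m by (simp add: h_Suc A.step_def)
    ultimately show ?thesis unfolding F.step_def by linarith
  qed
  have a_step: "F.step k (a M N) x + G N x \<le> a M (Suc N) x" if "N \<le> M" for M N x
  proof -
    \<comment> \<open>The upper end term is 1 because \<open>N \<le> M\<close>: from level
      \<open>k + M\<close>, \<open>N\<close> steps cannot lead below \<open>k\<close>.\<close>
    have telescope: "(\<Sum>m=k..<k + M. h N (x(r := Suc m)) - h N (x(r := m))) = 1 - h N (x(r := k))"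
      using sum_Suc_diff'[of k "k + M" "\<lambda>m. h N (x(r := m))"] h_one[of N "x(r := k + M)"] that by simp
    have "(\<Sum>m=k..<k + M. h N (x(r := m - 1)) - h N (x(r := m)))
        = - (\<Sum>m=k..<k + M. h N (x(r := Suc m - 1)) - h N (x(r := m - 1)))"
      by (simp add: sum_negf[symmetric])
    also have "\<dots> = h N (x(r := k - 1)) - h N (x(r := k + M - 1))"
      using sum_Suc_diff'[of k "k + M" "\<lambda>m. h N (x(r := m - 1))"] by simp
    also have "\<dots> \<ge> - 1" using h_bounds[of N "x(r := k - 1)"] h_bounds[of N "x(r := k + M - 1)"] by linarith
    finally have telescope': "- 1 \<le> (\<Sum>m=k..<k + M. h N (x(r := m - 1)) - h N (x(r := m)))" .
    have "\<nu> r - \<nu> r * h N (x(r := k)) - \<mu> r * c x \<le> \<nu> r * (1 - h N (x(r := k)))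
        + \<mu> r * c x * (\<Sum>m=k..<k + M. h N (x(r := m - 1)) - h N (x(r := m)))"
      using mult_left_mono[OF telescope', of "\<mu> r * c x"] \<mu>_pos[of r] c_bounds[of x]
      by (simp add: algebra_simps)
    then have "G N x \<le> (\<nu> r * (\<Sum>m=k..<k + M. h N (x(r := Suc m)) - h N (x(r := m)))
        + \<mu> r * c x * (\<Sum>m=k..<k + M. h N (x(r := m - 1)) - h N (x(r := m)))) / \<Lambda>"
      unfolding telescope G_def using \<Lambda>_pos by (intro divide_right_mono) auto
    also have "\<dots> = (\<Sum>m=k..<k + M. (\<nu> r * (h N (x(r := Suc m)) - h N (x(r := m)))
        + \<mu> r * c x * (h N (x(r := m - 1)) - h N (x(r := m)))) / \<Lambda>)"
      by (simp only: sum_distrib_left sum.distrib[symmetric] sum_divide_distrib)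
    finally have "F.step k (a M N) x + G N x \<le> (\<Sum>m=k..<k + M. F.step k (\<lambda>x. h N (x(r := m))) x
        + (\<nu> r * (h N (x(r := Suc m)) - h N (x(r := m)))
        + \<mu> r * c x * (h N (x(r := m - 1)) - h N (x(r := m)))) / \<Lambda>)"
      unfolding a_def F.step_sum[OF finite_atLeastLessThan] sum.distrib by simp
    also have "\<dots> \<le> a M (Suc N) x"
      unfolding a_def by (intro sum_mono h_step) auto
    finally show ?thesis .
  qed
  \<comment> \<open>A discrete Duhamel formula: the gain with index \<open>N - 1 - j\<close> is
    carried along by \<open>j\<close> further steps, starting from
    \<open>a M 0 x = M\<close>.\<close>
  have a_lower: "real M + (\<Sum>j<N. (F.step k ^^ j) (G (N - 1 - j)) x) \<le> a M N x" if "N \<le> M" for M N x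
    using that
  proof (induction N arbitrary: x)
    case 0
    then show ?case by (simp add: a_def h_0)
  next
    case (Suc N)
    have "real M + (\<Sum>j<Suc N. (F.step k ^^ j) (G (Suc N - 1 - j)) x)
        = real M + (\<Sum>j<N. (F.step k ^^ Suc j) (G (N - 1 - j)) x) + G N x"
      by (simp add: sum.lessThan_Suc_shift del: sum.lessThan_Suc)
    moreover have "real M + (\<Sum>j<N. (F.step k ^^ Suc j) (G (N - 1 - j)) x)
        = F.step k (\<lambda>x. real M + (\<Sum>j<N. (F.step k ^^ j) (G (N - 1 - j)) x)) x"
      by (simp add: F.step_add F.step_const F.step_sum)
    moreover have "F.step k (\<lambda>x. real M + (\<Sum>j<N. (F.step k ^^ j) (G (N - 1 - j)) x)) x
        \<le> F.step k (a M N) x"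
      using Suc by (intro F.step_le[OF F.closed_UNIV]) auto
    moreover have "F.step k (a M N) x + G N x \<le> a M (Suc N) x"
      using Suc.prems by (intro a_step) simp
    ultimately show ?case by linarith
  qed

  \<comment> \<open>Escape probability against drift. By comparison with \<open>\<pi>\<close>,
    \<open>q i\<close> bounds the mean of \<open>h i\<close> at level \<open>k\<close> for every
    number of preceding steps\<close>
  define q where "q i = (\<integral>x. h i (x(r := k)) \<partial>\<pi>)" for i
  have G_lower: "(\<nu> r - \<nu> r * q i - \<mu> r * (F.step k ^^ j) c z) / \<Lambda> \<le> (F.step k ^^ j) (G i) z" for i j
  proof -
    have "G i = (\<lambda>x. (1 / \<Lambda>) * (\<nu> r - \<nu> r * h i (x(r := k)) - \<mu> r * c x))"
      by (simp add: G_def fun_eq_iff)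
    then have "(F.step k ^^ j) (G i) z = (1 / \<Lambda>) * (\<nu> r
        - \<nu> r * (F.step k ^^ j) (\<lambda>x. h i (x(r := k))) z - \<mu> r * (F.step k ^^ j) c z)"
      by (simp only: F.pow_cmult F.pow_diff F.pow_const)
    moreover have "(F.step k ^^ j) (\<lambda>x. h i (x(r := k))) z \<le> q i"
      unfolding q_def
    proof (rule dom)
      show "mono (\<lambda>x. h i (x(r := k)))"
        by (rule monoI, rule monoD[OF h_mono]) (auto simp: le_fun_def)
      show "\<bar>h i (n(r := k))\<bar> \<le> 1" for n using h_bounds[of i "n(r := k)"] by simp
    qed simp
    ultimately show ?thesis
      using \<nu>_pos[of r] \<Lambda>_pos by (simp add: divide_right_mono)
  qed
  define t where "t j = \<mu> r * (F.step k ^^ j) c z" for j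
  \<comment> \<open>With \<open>M = N\<close>, the sum \<open>a N N z\<close> has \<open>N\<close>
    terms of size at most 1, so the accumulated gains are at most 0. Reversing the order of
    summation turns \<open>N - 1 - j\<close> into \<open>j\<close>.\<close>
  have sum_le: "(\<Sum>j<N. \<nu> r - \<nu> r * q j - t j) \<le> 0" for N
  proof -
    have "a N N z \<le> real N"
      using sum_bounded_above[of "{k..<k + N}" "\<lambda>m. h N (z(r := m))" 1] h_bounds by (simp add: a_def)
    then have "(\<Sum>j<N. (F.step k ^^ j) (G (N - 1 - j)) z) \<le> 0"
      using a_lower[of N N z] by simp
    moreover have "(\<Sum>j<N. (\<nu> r - \<nu> r * q (N - 1 - j) - t j) / \<Lambda>)
        \<le> (\<Sum>j<N. (F.step k ^^ j) (G (N - 1 - j)) z)"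
      unfolding t_def by (intro sum_mono G_lower)
    ultimately have "(\<Sum>j<N. \<nu> r - \<nu> r * q (N - 1 - j) - t j) / \<Lambda> \<le> 0"
      by (simp add: sum_divide_distrib)
    then have "(\<Sum>j<N. \<nu> r - \<nu> r * q (N - 1 - j) - t j) \<le> 0"
      using \<Lambda>_pos by (simp add: divide_le_0_iff)
    moreover have "(\<Sum>j<N. q (N - 1 - j)) = (\<Sum>j<N. q j)"
      using sum.nat_diff_reindex[of q N] by simp
    ultimately show ?thesis by (simp add: sum_subtractf sum_distrib_left[symmetric])
  qed

  \<comment> \<open>The limiting escape probability\<close>
  have "convergent (\<lambda>N. h N n)" for n
    using h_dec h_bounds by (intro Bseq_monoseq_convergent decseq_imp_monoseq decseq_SucI BseqI'[of _ 1]) auto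
  then obtain l where l: "\<And>n. (\<lambda>N. h N n) \<longlonglongrightarrow> l n"
    unfolding convergent_def by metis
  have l_bounds: "0 \<le> l n \<and> l n \<le> 1" for n
    using h_bounds by (auto intro: LIMSEQ_le_const[OF l] LIMSEQ_le_const2[OF l])
  have l_mono: "l n \<le> l m" if "n \<le> m" for n m
    using monoD[OF h_mono that] by (intro LIMSEQ_le[OF l l]) auto
  \<comment> \<open>From level \<open>k\<close> on this is an equality, the limit of the recursion
    for \<open>h\<close>; below \<open>k\<close> the function \<open>l\<close> is 0.\<close>
  have l_step: "l n \<le> A.step ?T l n" for n
  proof (cases "k \<le> n r")
    case True
    then have "(\<lambda>N. h (Suc N) n) \<longlonglongrightarrow> A.step ?T l n"
      using A.tendsto_step[of h l, OF l] by (simp add: h_Suc)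
    then show ?thesis using LIMSEQ_Suc[OF l[of n]] LIMSEQ_unique by fastforce
  next
    case False
    then have "h N n = 0" for N by (cases N) (auto simp: h_0 h_Suc)
    then have "l n = 0" using l[of n] by (simp add: LIMSEQ_const_iff)
    then show ?thesis using step_bounds[of l n] l_bounds by simp
  qed
  have l_v: "l v = 0"
  proof -
    have "h N v = 0" for N using k(2) by (cases N) (auto simp: h_0 h_Suc)
    then show ?thesis using l[of v] by (simp add: LIMSEQ_const_iff)
  qed

  \<comment> \<open>Otherwise \<open>q\<close> tends to 0; since \<open>t\<close> is decreasing, the
    terms in \<open>sum_le\<close> would eventually be at least \<open>\<delta> / 2\<close>.\<close>
  have "\<exists>x\<in>set_pmf \<pi>. l (x(r := k)) \<noteq> 0"
  proof (rule ccontr)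
    assume no: "\<not> ?thesis"
    have "q \<longlonglongrightarrow> (\<integral>x. 0 \<partial>\<pi>)"
      unfolding q_def
    proof (rule integral_dominated_convergence[where w = "\<lambda>_. 1"])
      show "AE x in \<pi>. (\<lambda>i. h i (x(r := k))) \<longlonglongrightarrow> 0"
        using no l by (intro AE_pmfI) metis
    qed (use h_bounds in auto)
    then have "(\<lambda>i. \<nu> r * q i) \<longlonglongrightarrow> \<nu> r * 0" by (intro tendsto_intros) simp
    moreover define \<delta> where "\<delta> = \<nu> r - t J"
    moreover have \<delta>: "0 < \<delta>"
      using k(1) \<mu>_pos[of r] by (simp add: \<delta>_def t_def field_simps)
    ultimately have "eventually (\<lambda>i. \<nu> r * q i < \<delta> / 2) sequentially"
      by (intro order_tendstoD(2)) auto
    then obtain I where I: "\<And>i. I \<le> i \<Longrightarrow> \<nu> r * q i < \<delta> / 2"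
      by (auto simp: eventually_sequentially)
    have "\<delta> / 2 \<le> \<nu> r - \<nu> r * q j - t j" if "max I J \<le> j" for j
    proof -
      have "(F.step k ^^ j) c z \<le> (F.step k ^^ J) c z"
        using that by (intro F.pow_antimono_at_origin c_anti z0) auto
      then have "t j \<le> t J" using \<mu>_pos[of r] by (simp add: t_def)
      then show ?thesis using I[of j] that by (simp add: \<delta>_def)
    qed
    then show False
      using no_eventually_positive_partial_sums[of "\<delta> / 2" "max I J" "\<lambda>j. \<nu> r - \<nu> r * q j - t j" 0]
        sum_le \<delta> by simp
  qed
  then obtain x where x: "x \<in> set_pmf \<pi>" "l (x(r := k)) \<noteq> 0" by blast

  text \<open>Under \<open>\<rho>\<close> the subharmonic \<open>l\<close> is harmonic, so its zero at \<open>v\<close> spreads along arrivals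
    to a state above one where \<open>l\<close> is positive.\<close>

  have "(\<integral>n. A.step ?T l n - l n \<partial>\<rho>) = 0"
  proof -
    have int: "integrable \<rho> f" if "\<And>n. 0 \<le> f n \<and> f n \<le> 1" for f :: "_ \<Rightarrow> real"
      using that by (intro measure_pmf.integrable_const_bound[where B = 1]) auto
    have "(\<integral>n. A.step ?T l n - l n \<partial>\<rho>) = (\<integral>n. A.step ?T l n \<partial>\<rho>) - (\<integral>n. l n \<partial>\<rho>)"
      using l_bounds step_bounds by (intro Bochner_Integration.integral_diff int) auto
    then show ?thesis using A.invariant_step[OF \<rho>(2), of l 1] l_bounds by simp
  qed
  moreover have "integrable \<rho> (\<lambda>n. A.step ?T l n - l n)"
  proof (rule measure_pmf.integrable_const_bound[where B = 1])
    show "AE n in \<rho>. norm (A.step ?T l n - l n) \<le> 1"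
      using step_bounds[of l] l_bounds l_step by (intro AE_pmfI) (smt (verit) real_norm_def)
  qed simp
  ultimately have harmonic: "A.step ?T l n = l n" if "n \<in> set_pmf \<rho>" for n
    using integral_nonneg_eq_0_iff_AE[of \<rho> "\<lambda>n. A.step ?T l n - l n"] l_step that
    by (auto simp: AE_measure_pmf_iff)
  define m where "m s = max (v s) ((x(r := k)) s)" for s
  have "m \<in> set_pmf \<rho> \<and> l m = 0"
  proof (rule A.climb[of _ v ?T])
    show "v \<in> set_pmf \<rho> \<and> l v = 0" using v l_v by simp
    show "v \<le> m" by (simp add: m_def le_fun_def)
    \<comment> \<open>Outside \<open>insert r S\<close> both \<open>v\<close> and \<open>x\<close>
      have the value \<open>undefined\<close>, so \<open>m\<close> differs from \<open>v\<close>
      only in coordinates with arrivals.\<close>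
    show "m \<in> A.fibre ?T v"
      using v \<rho>(1) x(1) \<pi>(1)
      by (fastforce simp: A.fibre_def arr_eq_0_iff m_def states_def PiE_def extensional_def)
  next
    fix n s assume n: "n \<in> set_pmf \<rho> \<and> l n = 0" and s: "arr ?T s \<noteq> 0"
    have "inc s n \<in> set_pmf (bind_pmf \<rho> (A.ker ?T))"
      using n A.inc_in_set_ker[OF s] by auto
    moreover have "l (inc s n) = 0"
    proof -
      \<comment> \<open>As \<open>l n = 0\<close>, harmonicity at \<open>n\<close> says that a sum
        of nonnegative terms is 0.\<close>
      let ?t = "\<lambda>s. arr ?T s * (l (inc s n) - l n) + dep ?T n s * (l (dec s n) - l n)"
      have "(\<Sum>s\<in>UNIV. ?t s) = 0"
        using harmonic[of n] n \<Lambda>_pos by (simp add: A.step_def)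
      moreover have "0 \<le> ?t s" for s
        using n l_bounds A.a_nonneg[of ?T s] A.d_nonneg[of ?T n s] by simp
      ultimately have "?t s = 0" by (simp add: sum_nonneg_eq_0_iff)
      moreover have "0 \<le> dep ?T n s * l (dec s n)" "0 \<le> arr ?T s * l (inc s n)"
        using l_bounds A.a_nonneg[of ?T s] A.d_nonneg[of ?T n s] by auto
      ultimately have "arr ?T s * l (inc s n) = 0" using n by (simp only: diff_zero)
      then show ?thesis using s by simp
    qed
    ultimately show "inc s n \<in> set_pmf \<rho> \<and> l (inc s n) = 0" by (simp add: \<rho>(2))
  qed
  moreover have "l (x(r := k)) \<le> l m" by (rule l_mono) (simp add: m_def le_fun_def)
  ultimately show False using x(2) l_bounds[of "x(r := k)"] by simp
qed

end

theorem theorem3p1: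
  fixes \<nu> \<mu> \<kappa> :: "'r::finite \<Rightarrow> real"
    and b :: "('r \<Rightarrow> nat) \<Rightarrow> 'r \<Rightarrow> real"
    and S :: "'r set"
    and \<pi> :: "('r \<Rightarrow> nat) pmf"
  assumes "\<And>r. \<nu> r > 0"
    and "\<And>r. \<mu> r > 0"
    and "\<And>r. \<kappa> r = \<nu> r / \<mu> r"
    and "monotonic_control b"
    and "stable_control \<nu> \<mu> b S"
    and "stationary_distribution (states S) (rates \<nu> \<mu> b S) \<pi>"
  shows "(\<forall>r. r \<notin> S \<and> measure_pmf.expectation \<pi> (\<lambda>n. limit_control b S n r) > \<kappa> r
            \<longrightarrow> stable_control \<nu> \<mu> b (S \<union> {r}))
       \<and> (\<forall>r. r \<notin> S \<and> measure_pmf.expectation \<pi> (\<lambda>n. limit_control b S n r) < \<kappa> r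
            \<longrightarrow> \<not> stable_control \<nu> \<mu> b (S \<union> {r}))"
proof -
  have bounded: "bounded (range (\<lambda>n. b n r))" for r
    using assms(4) by (simp add: monotonic_control_def bounded_control_def)
  then obtain C where C: "\<And>r n. \<bar>b n r\<bar> \<le> C r"
    unfolding bounded_real by (metis rangeI)
  \<comment> \<open>Finiteness of the index type yields one bound for all coordinates.\<close>
  have "b n r \<le> Max (range C)" for n r
  proof -
    have "C r \<le> Max (range C)" by simp
    then show ?thesis using C[where r = r and n = n] by linarith
  qed
  then interpret monotonic_network \<nu> \<mu> b "Max (range C)"
    using assms(1,2,4) by unfold_locales auto
  have \<pi>: "set_pmf \<pi> \<subseteq> states S" "bind_pmf \<pi> (A.ker S) = \<pi>"
    using assms(6) by (auto simp: stationary_distribution_iff)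
  have stable_iff: "stable_control \<nu> \<mu> b (S \<union> {r}) \<longleftrightarrow> (\<exists>\<rho>. set_pmf \<rho> \<subseteq> states (insert r S)
      \<and> bind_pmf \<rho> (A.ker (insert r S)) = \<rho>)" for r
    by (simp add: stable_control_def positive_recurrent_def stationary_distribution_iff)
  show ?thesis
    unfolding stable_iff assms(3)
    using expectation_pos_imp_stable[OF _ \<pi>] expectation_neg_imp_unstable[OF _ \<pi>] by blast
qed

end
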